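(* Let $\mathcal{P}$ be the digraph property of not containing $DK_3$, and let $\pi(\mathcal{P})$ be its entropy density. The number of digraphs on the labelled vertex set $[n]$ not containing any $DK_3$ is $$4^{\pi(\mathcal{P})\binom n2+o(n^2)}=3^{\binom n2-\lfloor n^2/4\rfloor}\,4^{\lfloor n^2/4\rfloor+o(n^2)}\qquad(n\to\infty).$$
   Context: A digraph on $[n]$ is a set of ordered pairs $\vec{ij}$ of distinct elements of $[n]$; both $\vec{ij}$ and $\vec{ji}$ may be present, in which case $ij$ is a double edge. $DK_3$ is the double triangle: three vertices with all three pairs being double edges. Not containing $DK_3$ means that there are no three vertices all three pairs of which are double edges. A digraph $D$ on $[n]$ is encoded as a $4$-colouring $c$ of $E(K_n)$: for $i<j$, $c(ij)=1$ if neither $\vec{ij}$ nor $\vec{ji}$ is in $D$, $2$ if only $\vec{ij}$ is, $3$ if only $\vec{ji}$ is, $4$ if both are. Under this encoding $\mathcal{P}_n$ is the set of $4$-colourings of $E(K_n)$ with no triangle all of whose edges have colour $4$. A template for $K_n$ is a function $t$ assigning to each edge $e$ a nonempty set $t(e)\subseteq\{1,2,3,4\}$; $\langle t\rangle$ is the set of colourings $c$ with $c(e)\in t(e)$ for all $e$; $\mathrm{Ent}(t)=\sum_e\log_4|t(e)|$; $\mathrm{ex}(n,\mathcal{P})=\max\{\mathrm{Ent}(t):\langle t\rangle\subseteq\mathcal{P}_n\}$; and $\pi(\mathcal{P})=\lim_{n\to\infty}\mathrm{ex}(n,\mathcal{P})/\binom n2$ (the limit exists). *)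

theory Defs
  imports Complex_Main "HOL-Library.FuncSet" "HOL-Library.Landau_Symbols"
begin

definition digraphs :: "nat \<Rightarrow> (nat \<times> nat) set set" where
  "digraphs n = {D. D \<subseteq> {1..n} \<times> {1..n} \<and> (\<forall>(i, j)\<in>D. i \<noteq> j)}"

definition double_edge :: "(nat \<times> nat) set \<Rightarrow> nat \<Rightarrow> nat \<Rightarrow> bool" where
  "double_edge D i j \<longleftrightarrow> (i, j) \<in> D \<and> (j, i) \<in> D"

definition contains_DK3 :: "(nat \<times> nat) set \<Rightarrow> bool" where
  "contains_DK3 D \<longleftrightarrow> (\<exists>i j k. i \<noteq> j \<and> i \<noteq> k \<and> j \<noteq> k \<and>
     double_edge D i j \<and> double_edge D i k \<and> double_edge D j k)"

definition DK3_free_digraphs :: "nat \<Rightarrow> (nat \<times> nat) set set" where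
  "DK3_free_digraphs n = {D \<in> digraphs n. \<not> contains_DK3 D}"

definition K_edges :: "nat \<Rightarrow> nat set set" where
  "K_edges n = {e. e \<subseteq> {1..n} \<and> card e = 2}"

text \<open>Functions on the edge set are extensional (\<open>undefined\<close> off \<open>K_edges n\<close>), so that
  distinct colourings and templates correspond to distinct functions.\<close>

definition colourings :: "nat \<Rightarrow> (nat set \<Rightarrow> nat) set" where
  "colourings n = K_edges n \<rightarrow>\<^sub>E {1..4}"

definition encode :: "nat \<Rightarrow> (nat \<times> nat) set \<Rightarrow> nat set \<Rightarrow> nat" where
  "encode n D = (\<lambda>e\<in>K_edges n. let i = Min e; j = Max e in
     if (i, j) \<in> D then (if (j, i) \<in> D then 4 else 2)
     else (if (j, i) \<in> D then 3 else 1))"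

definition templates :: "nat \<Rightarrow> (nat set \<Rightarrow> nat set) set" where
  "templates n = K_edges n \<rightarrow>\<^sub>E (Pow {1..4} - {{}})"

definition realisations :: "nat \<Rightarrow> (nat set \<Rightarrow> nat set) \<Rightarrow> (nat set \<Rightarrow> nat) set" where
  "realisations n t = Pi\<^sub>E (K_edges n) t"

definition Ent :: "nat \<Rightarrow> (nat set \<Rightarrow> nat set) \<Rightarrow> real" where
  "Ent n t = (\<Sum>e\<in>K_edges n. log 4 (real (card (t e))))"

text \<open>A property \<open>P\<close> assigns to each \<open>n\<close> a set of colourings of the edges of the complete
  graph on \<open>{1..n}\<close>.\<close>

definition ex :: "(nat \<Rightarrow> (nat set \<Rightarrow> nat) set) \<Rightarrow> nat \<Rightarrow> real" where
  "ex P n = Max {Ent n t |t. t \<in> templates n \<and> realisations n t \<subseteq> P n}"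

definition entropy_density :: "(nat \<Rightarrow> (nat set \<Rightarrow> nat) set) \<Rightarrow> real" where
  "entropy_density P = lim (\<lambda>n. ex P n / real (n choose 2))"

definition DK3_free :: "nat \<Rightarrow> (nat set \<Rightarrow> nat) set" where
  "DK3_free n = encode n ` DK3_free_digraphs n"


subsection \<open>The encoding\<close>

lemma finite_K_edges [simp]: "finite (K_edges n)"
  unfolding K_edges_def by (rule finite_subset[of _ "Pow {1..n}"]) auto

lemma doubleton_K_edges: "{i, j} \<in> K_edges n \<longleftrightarrow> i \<in> {1..n} \<and> j \<in> {1..n} \<and> i \<noteq> j"
  unfolding K_edges_def by (auto simp: card_insert_if)

lemma K_edgesE:
  assumes "e \<in> K_edges n"
  obtains i j where "e = {i, j}" "i < j" "i \<in> {1..n}" "j \<in> {1..n}"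
proof -
  from assms obtain i j where e: "e = {i, j}" "i \<noteq> j" and sub: "e \<subseteq> {1..n}"
    unfolding K_edges_def card_2_iff by auto
  show ?thesis
    using that[of i j] that[of j i] e sub by (cases "i < j") (auto simp: insert_commute)
qed

lemma encode_less:
  assumes "i < j" "i \<in> {1..n}" "j \<in> {1..n}"
  shows "encode n D {i, j} = (if (i, j) \<in> D then (if (j, i) \<in> D then 4 else 2)
     else (if (j, i) \<in> D then 3 else 1))"
  using assms by (auto simp: encode_def doubleton_K_edges Let_def)

lemma encode_eq_4_iff:
  assumes "i \<noteq> j" "i \<in> {1..n}" "j \<in> {1..n}"
  shows "encode n D {i, j} = 4 \<longleftrightarrow> double_edge D i j"
proof (cases "i < j")
  case True
  then show ?thesis using assms by (simp add: encode_less double_edge_def)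
next
  case False
  then have "encode n D {j, i} = 4 \<longleftrightarrow> double_edge D i j"
    using assms by (subst encode_less) (auto simp: double_edge_def)
  then show ?thesis by (simp add: insert_commute)
qed

lemma bij_betw_encode: "bij_betw (encode n) (digraphs n) (colourings n)"
proof (rule bij_betw_imageI)
  show "inj_on (encode n) (digraphs n)"
  proof (rule inj_onI)
    fix D D' assume D: "D \<in> digraphs n" "D' \<in> digraphs n" and eq: "encode n D = encode n D'"
    have main: "((i, j) \<in> D \<longleftrightarrow> (i, j) \<in> D') \<and> ((j, i) \<in> D \<longleftrightarrow> (j, i) \<in> D')"
      if "i < j" "i \<in> {1..n}" "j \<in> {1..n}" for i j
    proof -
      have "encode n D {i, j} = encode n D' {i, j}" by (simp only: eq)
      then show ?thesis unfolding encode_less[OF that] by (simp split: if_split_asm)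
    qed
    have "(i, j) \<in> D \<longleftrightarrow> (i, j) \<in> D'" for i j
    proof (cases "i \<in> {1..n} \<and> j \<in> {1..n} \<and> i \<noteq> j")
      case True
      then show ?thesis using main[of i j] main[of j i] linorder_neqE_nat[of i j] by blast
    next
      case False
      then show ?thesis using D by (auto simp: digraphs_def)
    qed
    then show "D = D'" by auto
  qed
next
  show "encode n ` digraphs n = colourings n"
  proof (intro equalityI subsetI)
    fix c assume "c \<in> encode n ` digraphs n"
    then show "c \<in> colourings n"
      by (auto simp: encode_def colourings_def Let_def)
  next
    fix c assume c: "c \<in> colourings n"
    define D where "D = {(i, j). i \<in> {1..n} \<and> j \<in> {1..n} \<and> i \<noteq> j \<and>
      c {i, j} \<in> (if i < j then {2, 4} else {3, 4})}"
    have "D \<in> digraphs n" by (auto simp: D_def digraphs_def)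
    moreover have "encode n D = c"
    proof
      fix e
      show "encode n D e = c e"
      proof (cases "e \<in> K_edges n")
        case True
        then obtain i j where e: "e = {i, j}" "i < j" "i \<in> {1..n}" "j \<in> {1..n}"
          by (rule K_edgesE)
        have "c e \<in> {1..4}" using c True by (auto simp: colourings_def)
        then have "c {i, j} \<in> {1, 2, 3, 4}" by (simp only: e(1)) auto
        moreover have "(i, j) \<in> D \<longleftrightarrow> c {i, j} \<in> {2, 4}"
          using e by (simp add: D_def)
        moreover have "(j, i) \<in> D \<longleftrightarrow> c {i, j} \<in> {3, 4}"
          using e by (simp add: D_def insert_commute[of j i])
        ultimately show ?thesis
          unfolding e(1) encode_less[OF e(2-4)] by auto
      next
        case False
        then show ?thesis using c by (auto simp: encode_def colourings_def PiE_def extensional_def)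
      qed
    qed
    ultimately show "c \<in> encode n ` digraphs n" by blast
  qed
qed

lemma DK3_free_eq:
  "DK3_free n = {c \<in> colourings n. \<not> (\<exists>i\<in>{1..n}. \<exists>j\<in>{1..n}. \<exists>k\<in>{1..n}.
     i \<noteq> j \<and> i \<noteq> k \<and> j \<noteq> k \<and> c {i, j} = 4 \<and> c {i, k} = 4 \<and> c {j, k} = 4)}"
proof -
  have "contains_DK3 D \<longleftrightarrow> (\<exists>i\<in>{1..n}. \<exists>j\<in>{1..n}. \<exists>k\<in>{1..n}. i \<noteq> j \<and> i \<noteq> k \<and> j \<noteq> k \<and>
      encode n D {i, j} = 4 \<and> encode n D {i, k} = 4 \<and> encode n D {j, k} = 4)"
    if D: "D \<in> digraphs n" for D
  proof -
    have "i \<in> {1..n} \<and> j \<in> {1..n}" if "double_edge D i j" for i j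
      using that D by (auto simp: double_edge_def digraphs_def)
    then show ?thesis
      unfolding contains_DK3_def by (metis encode_eq_4_iff)
  qed
  then show ?thesis
    unfolding DK3_free_def DK3_free_digraphs_def bij_betw_imp_surj_on[OF bij_betw_encode, symmetric]
    by auto
qed


subsection \<open>Existence of the entropy density\<close>

definition DK3_free_template :: "nat \<Rightarrow> (nat set \<Rightarrow> nat set) \<Rightarrow> bool" where
  "DK3_free_template n t \<longleftrightarrow> t \<in> templates n \<and> realisations n t \<subseteq> DK3_free n"

lemma DK3_free_template_iff:
  "DK3_free_template n t \<longleftrightarrow> t \<in> templates n \<and> \<not> (\<exists>i\<in>{1..n}. \<exists>j\<in>{1..n}. \<exists>k\<in>{1..n}.
     i \<noteq> j \<and> i \<noteq> k \<and> j \<noteq> k \<and> 4 \<in> t {i, j} \<and> 4 \<in> t {i, k} \<and> 4 \<in> t {j, k})"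
proof (cases "t \<in> templates n")
  case t: True
  show ?thesis
  proof
    assume g: "DK3_free_template n t"
    show "t \<in> templates n \<and> \<not> (\<exists>i\<in>{1..n}. \<exists>j\<in>{1..n}. \<exists>k\<in>{1..n}.
     i \<noteq> j \<and> i \<noteq> k \<and> j \<noteq> k \<and> 4 \<in> t {i, j} \<and> 4 \<in> t {i, k} \<and> 4 \<in> t {j, k})"
    proof (intro conjI t notI, elim bexE conjE)
      fix i j k assume ijk: "i \<in> {1..n}" "j \<in> {1..n}" "k \<in> {1..n}" "i \<noteq> j" "i \<noteq> k" "j \<noteq> k"
        and 4: "4 \<in> t {i, j}" "4 \<in> t {i, k}" "4 \<in> t {j, k}"
      define c where "c = (\<lambda>e\<in>K_edges n. if 4 \<in> t e then 4 else SOME x. x \<in> t e)"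
      have "c \<in> realisations n t"
        using t by (auto simp: c_def realisations_def templates_def some_in_eq dest: PiE_mem)
      then have "c \<in> DK3_free n" using g by (auto simp: DK3_free_template_def)
      moreover have "c {i, j} = 4" "c {i, k} = 4" "c {j, k} = 4"
        using ijk 4 by (auto simp: c_def doubleton_K_edges)
      ultimately show False using ijk unfolding DK3_free_eq by blast
    qed
  next
    assume R: "t \<in> templates n \<and> \<not> (\<exists>i\<in>{1..n}. \<exists>j\<in>{1..n}. \<exists>k\<in>{1..n}.
     i \<noteq> j \<and> i \<noteq> k \<and> j \<noteq> k \<and> 4 \<in> t {i, j} \<and> 4 \<in> t {i, k} \<and> 4 \<in> t {j, k})"
    have "c \<in> DK3_free n" if c: "c \<in> realisations n t" for c
    proof -
      have mem: "c e \<in> t e" if "e \<in> K_edges n" for e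
        using c that by (auto simp: realisations_def)
      have "c \<in> colourings n"
        using c t unfolding realisations_def templates_def colourings_def PiE_iff by blast
      moreover have "4 \<in> t {i, j}" if "i \<in> {1..n}" "j \<in> {1..n}" "i \<noteq> j" "c {i, j} = 4" for i j
        using mem[of "{i, j}"] that by (simp add: doubleton_K_edges)
      ultimately show ?thesis using R unfolding DK3_free_eq by blast
    qed
    then show "DK3_free_template n t" using t by (auto simp: DK3_free_template_def)
  qed
qed (auto simp: DK3_free_template_def)

lemma ex_alt: "ex DK3_free n = Max (Ent n ` {t. DK3_free_template n t})"
  unfolding ex_def DK3_free_template_def by (rule arg_cong[of _ _ Max]) auto

lemma finite_DK3_free_template: "finite {t. DK3_free_template n t}"
  by (rule finite_subset[of _ "templates n"]) (auto simp: DK3_free_template_def templates_def intro!: finite_PiE)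

lemma DK3_free_template_nonempty: "{t. DK3_free_template n t} \<noteq> {}"
proof -
  have "DK3_free_template n (\<lambda>e\<in>K_edges n. {1})"
    unfolding DK3_free_template_iff by (auto simp: templates_def doubleton_K_edges)
  then show ?thesis by blast
qed

lemma Ent_le_ex: "DK3_free_template n t \<Longrightarrow> Ent n t \<le> ex DK3_free n"
  unfolding ex_alt by (rule Max_ge) (auto simp: finite_DK3_free_template)

lemma ex_attained:
  obtains t where "DK3_free_template n t" "Ent n t = ex DK3_free n"
proof -
  have "ex DK3_free n \<in> Ent n ` {t. DK3_free_template n t}"
    unfolding ex_alt using finite_DK3_free_template[of n] DK3_free_template_nonempty[of n] by (intro Max_in) auto
  then show ?thesis using that by auto
qed

lemma ex_nonneg: "0 \<le> ex DK3_free n"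
proof -
  obtain t where t: "DK3_free_template n t" "Ent n t = ex DK3_free n" by (rule ex_attained)
  have "0 \<le> log 4 (real (card (t e)))" if "e \<in> K_edges n" for e
  proof -
    have "t e \<noteq> {}" "t e \<subseteq> {1..4}" using t that by (auto simp: DK3_free_template_def templates_def)
    then have "card (t e) \<ge> 1"
      by (metis One_nat_def Suc_leI card_gt_0_iff finite_atLeastAtMost finite_subset)
    then show ?thesis by simp
  qed
  then have "0 \<le> Ent n t" unfolding Ent_def by (rule sum_nonneg)
  then show ?thesis using t by simp
qed

definition skip :: "nat \<Rightarrow> nat \<Rightarrow> nat" where
  "skip v i = (if i < v then i else Suc i)"

lemma inj_skip: "inj (skip v)"
  by (auto simp: inj_def skip_def split: if_splits)

lemma skip_image: "v \<in> {1..Suc n} \<Longrightarrow> skip v ` {1..n} = {1..Suc n} - {v}"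
proof (intro equalityI subsetI)
  fix x assume v: "v \<in> {1..Suc n}" and x: "x \<in> {1..Suc n} - {v}"
  show "x \<in> skip v ` {1..n}"
  proof (cases "x < v")
    case True
    then show ?thesis using v x by (intro image_eqI[of _ _ x]) (auto simp: skip_def)
  next
    case False
    then show ?thesis using v x by (intro image_eqI[of _ _ "x - 1"]) (auto simp: skip_def)
  qed
qed (auto simp: skip_def split: if_splits)

lemma bij_skip_edges:
  assumes v: "v \<in> {1..Suc n}"
  shows "bij_betw (image (skip v)) (K_edges n) {e \<in> K_edges (Suc n). v \<notin> e}"
proof (rule bij_betw_imageI)
  show "inj_on (image (skip v)) (K_edges n)"
    using inj_skip by (meson inj_image_eq_iff inj_onI)
  show "image (skip v) ` K_edges n = {e \<in> K_edges (Suc n). v \<notin> e}"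
  proof (intro equalityI subsetI)
    fix e assume "e \<in> image (skip v) ` K_edges n"
    then obtain e' where e': "e' \<subseteq> {1..n}" "card e' = 2" "e = skip v ` e'"
      by (auto simp: K_edges_def)
    have "e \<subseteq> {1..Suc n} - {v}" using e' skip_image[OF v] by blast
    moreover have "card e = 2"
      using e' inj_skip by (metis card_image inj_on_subset subset_UNIV)
    ultimately show "e \<in> {e \<in> K_edges (Suc n). v \<notin> e}" by (auto simp: K_edges_def)
  next
    fix e assume e: "e \<in> {e \<in> K_edges (Suc n). v \<notin> e}"
    then have "e \<subseteq> skip v ` {1..n}" using skip_image[OF v] by (auto simp: K_edges_def)
    then obtain e' where e': "e' \<subseteq> {1..n}" "e = skip v ` e'" by (meson subset_imageE)
    then have "card e' = 2"
      using e card_image[OF inj_on_subset[OF inj_skip[of v] subset_UNIV], of e']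
      by (simp add: K_edges_def)
    then show "e \<in> image (skip v) ` K_edges n" using e' by (auto simp: K_edges_def)
  qed
qed

lemma delete_vertex:
  assumes g: "DK3_free_template (Suc n) t" and v: "v \<in> {1..Suc n}"
  shows "(\<Sum>e | e \<in> K_edges (Suc n) \<and> v \<notin> e. log 4 (real (card (t e)))) \<le> ex DK3_free n"
proof -
  define s where "s = (\<lambda>e\<in>K_edges n. t (skip v ` e))"
  have im: "skip v ` e \<in> K_edges (Suc n)" if "e \<in> K_edges n" for e
    using bij_betw_apply[OF bij_skip_edges[OF v] that] by simp
  have "s \<in> templates n"
    using g im unfolding s_def DK3_free_template_def templates_def by (auto simp: PiE_iff)
  have sk: "skip v i \<in> {1..Suc n}" if "i \<in> {1..n}" for i
    using that skip_image[OF v] by blast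
  have s4: "4 \<in> t {skip v i, skip v j}"
    if "i \<in> {1..n}" "j \<in> {1..n}" "i \<noteq> j" "4 \<in> s {i, j}" for i j
    using that by (simp add: s_def doubleton_K_edges)
  have "DK3_free_template n s"
    unfolding DK3_free_template_iff
  proof (intro conjI \<open>s \<in> templates n\<close> notI, elim bexE conjE)
    fix i j k assume ijk: "i \<in> {1..n}" "j \<in> {1..n}" "k \<in> {1..n}" "i \<noteq> j" "i \<noteq> k" "j \<noteq> k"
      and 4: "4 \<in> s {i, j}" "4 \<in> s {i, k}" "4 \<in> s {j, k}"
    have "skip v i \<noteq> skip v j" "skip v i \<noteq> skip v k" "skip v j \<noteq> skip v k"
      using ijk inj_skip by (auto dest: injD)
    with s4[of i j] s4[of i k] s4[of j k] sk ijk 4 g[unfolded DK3_free_template_iff] show False by blast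
  qed
  have "(\<Sum>e | e \<in> K_edges (Suc n) \<and> v \<notin> e. log 4 (real (card (t e))))
      = (\<Sum>e\<in>K_edges n. log 4 (real (card (t (skip v ` e)))))"
    by (rule sum.reindex_bij_betw[OF bij_skip_edges[OF v], symmetric])
  also have "\<dots> = Ent n s" unfolding Ent_def s_def by (intro sum.cong) auto
  also have "\<dots> \<le> ex DK3_free n" by (rule Ent_le_ex) fact
  finally show ?thesis .
qed

lemma ex_Suc: "(real n - 1) * ex DK3_free (Suc n) \<le> (real n + 1) * ex DK3_free n"
proof -
  obtain t where t: "DK3_free_template (Suc n) t" "Ent (Suc n) t = ex DK3_free (Suc n)" by (rule ex_attained)
  define w where "w e = log 4 (real (card (t e)))" for e
  let ?V = "{1..Suc n}" and ?E = "K_edges (Suc n)"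
  have cnt: "real (card {v \<in> ?V. v \<notin> e}) = real n - 1" if "e \<in> ?E" for e
  proof -
    have e: "e \<subseteq> ?V" "card e = 2" "finite e"
      using that finite_subset[of e ?V] by (auto simp: K_edges_def)
    have "{v \<in> ?V. v \<notin> e} = ?V - e" by auto
    moreover have "card (?V - e) = Suc n - 2" using e by (simp add: card_Diff_subset)
    moreover have "2 \<le> Suc n" using e card_mono[of ?V e] by simp
    ultimately show ?thesis by (simp add: of_nat_diff)
  qed
  have "(real n - 1) * ex DK3_free (Suc n) = (\<Sum>e\<in>?E. (real n - 1) * w e)"
    unfolding t(2)[symmetric] Ent_def w_def by (rule sum_distrib_left)
  also have "\<dots> = (\<Sum>e\<in>?E. \<Sum>v | v \<in> ?V \<and> v \<notin> e. w e)"
    by (intro sum.cong refl) (simp add: cnt[symmetric])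
  also have "\<dots> = (\<Sum>v\<in>?V. \<Sum>e | e \<in> ?E \<and> v \<notin> e. w e)"
    by (rule sum.swap_restrict) auto
  also have "\<dots> \<le> (\<Sum>v\<in>?V. ex DK3_free n)"
    unfolding w_def by (intro sum_mono delete_vertex t(1))
  also have "\<dots> = (real n + 1) * ex DK3_free n" by simp
  finally show ?thesis .
qed

text \<open>Hence \<open>entropy_density DK3_free\<close> is a genuine limit.\<close>

theorem convergent_entropy_density: "convergent (\<lambda>n. ex DK3_free n / real (n choose 2))"
proof -
  let ?f = "\<lambda>n. ex DK3_free n / real (n choose 2)"
  have ch: "real (m choose 2) = real m * (real m - 1) / 2" if "m \<ge> 1" for m
  proof -
    have "real (m choose 2) = real (m * (m - 1)) / real 2"
      unfolding choose_two by (rule real_of_nat_div) auto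
    then show ?thesis using that by (simp add: of_nat_diff)
  qed
  have "?f (Suc n) \<le> ?f n" if n: "n \<ge> 2" for n
  proof -
    let ?N = "real n"
    have N: "?N > 1" using n by simp
    have c: "real (Suc n choose 2) = (?N + 1) * ?N / 2" using ch[of "Suc n"] by simp
    have "?f (Suc n) = (?N - 1) * ex DK3_free (Suc n) / ((?N - 1) * ((?N + 1) * ?N / 2))"
      unfolding c using N by (subst mult_divide_mult_cancel_left) auto
    also have "\<dots> \<le> (?N + 1) * ex DK3_free n / ((?N - 1) * ((?N + 1) * ?N / 2))"
      using N by (intro divide_right_mono ex_Suc) simp
    also have "\<dots> = (?N + 1) * ex DK3_free n / ((?N + 1) * (?N * (?N - 1) / 2))"
      by (simp add: mult_ac)
    also have "\<dots> = ?f n"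
      using N n by (subst mult_divide_mult_cancel_left) (auto simp: ch)
    finally show ?thesis .
  qed
  then have dec: "decseq (\<lambda>n. ?f (n + 2))" by (intro decseq_SucI) simp
  have "convergent (\<lambda>n. ?f (n + 2))"
    using decseq_convergent[OF dec, of 0] ex_nonneg
    by (metis (no_types, lifting) convergentI divide_nonneg_nonneg of_nat_0_le_iff)
  then show ?thesis by (simp only: convergent_ignore_initial_segment[of ?f 2])
qed

end

theory Submission
  imports Defs "HOL-Analysis.Convex"
begin

text \<open>The double edges of a digraph without \<open>DK\<^sub>3\<close> form a triangle-free graph, and every other pair
  has three states. A balanced bipartite graph of potential double edges gives the lower bound. For
  the upper bound, a triangle-free graph \<open>A\<close> on \<open>n\<close> vertices is put into one of few containers:
  sort the vertices by their neighbourhoods in a set \<open>S\<close> and average \<open>A\<close> over pairs of classes.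
  An energy increment argument gives \<open>S\<close> of bounded size such that no single further vertex increases
  the energy of the average by much. Then the averaged graph has few triangles, so by Goodman's
  inequality at most \<open>(1 / 4 + \<delta>) * n\<^sup>2\<close> pairs have density above \<open>\<delta>\<close>. These pairs miss at most
  \<open>\<delta> * n\<^sup>2\<close> edges of \<open>A\<close>, and there are only \<open>2 ^ O(n)\<close> possibilities for the classes together with
  the set of dense class pairs. The entropy density is squeezed between the two bounds.\<close>

subsection \<open>Conditional averages\<close>

text \<open>The conditional expectation of \<open>g\<close> given \<kappa>, for the uniform measure
  on \<open>X\<close>. An empty fibre gives the value 0.\<close>

definition cond_avg :: "'a set \<Rightarrow> ('a \<Rightarrow> 'k) \<Rightarrow> ('a \<Rightarrow> real) \<Rightarrow> 'a \<Rightarrow> real" where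
  "cond_avg X \<kappa> g x = (\<Sum>y | y \<in> X \<and> \<kappa> y = \<kappa> x. g y) / real (card {y \<in> X. \<kappa> y = \<kappa> x})"

lemma cond_avg_cong: "\<kappa> x = \<kappa> y \<Longrightarrow> cond_avg X \<kappa> g x = cond_avg X \<kappa> g y"
  by (simp add: cond_avg_def)

lemma cond_avg_nonneg: "(\<And>y. y \<in> X \<Longrightarrow> 0 \<le> g y) \<Longrightarrow> 0 \<le> cond_avg X \<kappa> g x"
  unfolding cond_avg_def by (intro divide_nonneg_nonneg sum_nonneg) auto

lemma cond_avg_le_1:
  assumes "\<And>y. y \<in> X \<Longrightarrow> g y \<le> 1"
  shows "cond_avg X \<kappa> g x \<le> 1"
proof -
  have "(\<Sum>y | y \<in> X \<and> \<kappa> y = \<kappa> x. g y) \<le> real (card {y \<in> X. \<kappa> y = \<kappa> x}) * 1"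
    by (rule sum_bounded_above) (use assms in auto)
  then show ?thesis unfolding cond_avg_def by (simp add: divide_le_eq)
qed

text \<open>Conditional expectation is an orthogonal projection: in the double sum over pairs in a
  common fibre, \<open>F\<close> and the fibre size may be read at either point, so the order of
  summation can be exchanged and the fibre size cancels.\<close>

lemma sum_cond_avg_mult:
  assumes fin: "finite X"
    and F: "\<And>x y. x \<in> X \<Longrightarrow> y \<in> X \<Longrightarrow> \<kappa> x = \<kappa> y \<Longrightarrow> F x = F y"
  shows "(\<Sum>x\<in>X. cond_avg X \<kappa> g x * F x) = (\<Sum>x\<in>X. g x * F x)"
proof -
  define c where "c x = real (card {y \<in> X. \<kappa> y = \<kappa> x})" for x
  have cpos: "c x > 0" if "x \<in> X" for x
    unfolding c_def using that fin by (simp add: card_gt_0_iff) blast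
  have "(\<Sum>x\<in>X. cond_avg X \<kappa> g x * F x)
      = (\<Sum>x\<in>X. \<Sum>y | y \<in> X \<and> \<kappa> y = \<kappa> x. g y * F y / c y)"
  proof (rule sum.cong[OF refl])
    fix x assume x: "x \<in> X"
    have "cond_avg X \<kappa> g x * F x = (\<Sum>y | y \<in> X \<and> \<kappa> y = \<kappa> x. g y * (F x / c x))"
      unfolding sum_distrib_right[symmetric] by (simp add: cond_avg_def c_def)
    also have "\<dots> = (\<Sum>y | y \<in> X \<and> \<kappa> y = \<kappa> x. g y * F y / c y)"
    proof (rule sum.cong[OF refl])
      fix y assume y: "y \<in> {y. y \<in> X \<and> \<kappa> y = \<kappa> x}"
      then have "F x = F y" using F[of x y] x by simp
      moreover have "c x = c y" using y by (simp add: c_def)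
      ultimately show "g y * (F x / c x) = g y * F y / c y" by simp
    qed
    finally show "cond_avg X \<kappa> g x * F x = (\<Sum>y | y \<in> X \<and> \<kappa> y = \<kappa> x. g y * F y / c y)" .
  qed
  also have "\<dots> = (\<Sum>y\<in>X. \<Sum>x | x \<in> X \<and> \<kappa> y = \<kappa> x. g y * F y / c y)"
    by (rule sum.swap_restrict) (use fin in auto)
  also have "\<dots> = (\<Sum>y\<in>X. c y * (g y * F y / c y))"
  proof (rule sum.cong[OF refl])
    fix y
    have "{x. x \<in> X \<and> \<kappa> y = \<kappa> x} = {x \<in> X. \<kappa> x = \<kappa> y}" by auto
    then show "(\<Sum>x | x \<in> X \<and> \<kappa> y = \<kappa> x. g y * F y / c y) = c y * (g y * F y / c y)"
      by (simp add: c_def)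
  qed
  also have "\<dots> = (\<Sum>y\<in>X. g y * F y)"
    by (intro sum.cong refl) (simp add: less_imp_neq[OF cpos, symmetric])
  finally show ?thesis .
qed

text \<open>Pythagoras for a refinement \<open>\<kappa>'\<close> of \<kappa>. The coarse average is
  constant on the fibres of both keys, so its inner products with \<open>g\<close>, with the fine
  average and with itself all agree.\<close>

lemma sum_cond_avg_diff_squared:
  assumes fin: "finite X"
    and ref: "\<And>x y. x \<in> X \<Longrightarrow> y \<in> X \<Longrightarrow> \<kappa>' x = \<kappa>' y \<Longrightarrow> \<kappa> x = \<kappa> y"
  shows "(\<Sum>x\<in>X. (cond_avg X \<kappa>' g x - cond_avg X \<kappa> g x)\<^sup>2)
       = (\<Sum>x\<in>X. (cond_avg X \<kappa>' g x)\<^sup>2) - (\<Sum>x\<in>X. (cond_avg X \<kappa> g x)\<^sup>2)"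
proof -
  let ?p = "cond_avg X \<kappa> g" and ?q = "cond_avg X \<kappa>' g"
  have "(\<Sum>x\<in>X. ?q x * ?p x) = (\<Sum>x\<in>X. g x * ?p x)"
    by (rule sum_cond_avg_mult[OF fin]) (metis ref cond_avg_cong)
  moreover have "(\<Sum>x\<in>X. ?p x * ?p x) = (\<Sum>x\<in>X. g x * ?p x)"
    by (rule sum_cond_avg_mult[OF fin]) (metis cond_avg_cong)
  ultimately have "(\<Sum>x\<in>X. ?q x * ?p x) = (\<Sum>x\<in>X. (?p x)\<^sup>2)"
    by (simp add: power2_eq_square)
  moreover have "(\<Sum>x\<in>X. (?q x - ?p x)\<^sup>2)
      = (\<Sum>x\<in>X. (?q x)\<^sup>2) + (\<Sum>x\<in>X. (?p x)\<^sup>2) - 2 * (\<Sum>x\<in>X. ?q x * ?p x)"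
    by (simp add: power2_diff sum.distrib sum_subtractf sum_distrib_left mult.assoc)
  ultimately show ?thesis by simp
qed

subsection \<open>Containers for triangle-free graphs\<close>

text \<open>Equal keys define the vertex classes: there are at most \<open>2 ^ card S\<close> of
  them, and adjacency to any \<open>s\<close> in \<open>S\<close> is constant on each.\<close>

definition nbr_key :: "('a \<Rightarrow> 'a \<Rightarrow> bool) \<Rightarrow> 'a set \<Rightarrow> 'a \<Rightarrow> 'a set" where
  "nbr_key A S u = {s \<in> S. A s u}"

definition pair_key :: "('a \<Rightarrow> 'a \<Rightarrow> bool) \<Rightarrow> 'a set \<Rightarrow> 'a \<times> 'a \<Rightarrow> 'a set \<times> 'a set" where
  "pair_key A S = (\<lambda>(u, v). (nbr_key A S u, nbr_key A S v))"

definition step_density :: "'a set \<Rightarrow> ('a \<Rightarrow> 'a \<Rightarrow> bool) \<Rightarrow> 'a set \<Rightarrow> 'a \<times> 'a \<Rightarrow> real" where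
  "step_density V A S = cond_avg (V \<times> V) (pair_key A S) (\<lambda>(u, v). of_bool (A u v))"

text \<open>The squared L2 norm of the averaged graph, left unnormalised; it lies between 0 and the
  square of \<open>card V\<close>.\<close>

definition energy :: "'a set \<Rightarrow> ('a \<Rightarrow> 'a \<Rightarrow> bool) \<Rightarrow> 'a set \<Rightarrow> real" where
  "energy V A S = (\<Sum>x\<in>V \<times> V. (step_density V A S x)\<^sup>2)"

lemma nbr_key_mono: "S \<subseteq> S' \<Longrightarrow> nbr_key A S' u = nbr_key A S' v \<Longrightarrow> nbr_key A S u = nbr_key A S v"
  by (auto simp: nbr_key_def set_eq_iff subset_iff)

lemma pair_key_mono: "S \<subseteq> S' \<Longrightarrow> pair_key A S' x = pair_key A S' y \<Longrightarrow> pair_key A S x = pair_key A S y"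
  by (auto simp: pair_key_def split: prod.splits dest: nbr_key_mono)

lemma step_density_cong:
  "nbr_key A S u = nbr_key A S u' \<Longrightarrow> nbr_key A S v = nbr_key A S v' \<Longrightarrow>
    step_density V A S (u, v) = step_density V A S (u', v')"
  unfolding step_density_def by (rule cond_avg_cong) (simp add: pair_key_def)

lemma step_density_nonneg: "0 \<le> step_density V A S x"
  unfolding step_density_def by (rule cond_avg_nonneg) auto

lemma step_density_le_1: "step_density V A S x \<le> 1"
  unfolding step_density_def by (rule cond_avg_le_1) auto

lemma energy_le: "finite V \<Longrightarrow> energy V A S \<le> (real (card V))\<^sup>2"
proof -
  assume "finite V"
  have "energy V A S \<le> real (card (V \<times> V)) * 1"
    unfolding energy_def
    by (intro sum_bounded_above power_le_one step_density_nonneg step_density_le_1)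
  then show ?thesis by (simp add: card_cartesian_product power2_eq_square)
qed

lemma energy_nonneg: "0 \<le> energy V A S"
  unfolding energy_def by (intro sum_nonneg) auto

text \<open>Against a weight that depends only on the classes of \<open>u\<close> and
  \<open>v\<close>, averaging over class pairs is invisible. This is the exact exchange of density
  and adjacency.\<close>

lemma sum_step_density_mult:
  assumes "finite V"
    and "\<And>u v u' v'. nbr_key A S u = nbr_key A S u' \<Longrightarrow> nbr_key A S v = nbr_key A S v' \<Longrightarrow> F u v = F u' v'"
  shows "(\<Sum>u\<in>V. \<Sum>v\<in>V. step_density V A S (u, v) * F u v) = (\<Sum>u\<in>V. \<Sum>v\<in>V. of_bool (A u v) * F u v)"
proof -
  have "(\<Sum>x\<in>V \<times> V. step_density V A S x * (case x of (u, v) \<Rightarrow> F u v))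
      = (\<Sum>x\<in>V \<times> V. (case x of (u, v) \<Rightarrow> of_bool (A u v)) * (case x of (u, v) \<Rightarrow> F u v))"
    unfolding step_density_def
  proof (rule sum_cond_avg_mult)
    fix x y assume "pair_key A S x = pair_key A S y"
    then show "(case x of (u, v) \<Rightarrow> F u v) = (case y of (u, v) \<Rightarrow> F u v)"
      unfolding pair_key_def by (auto split: prod.splits intro: assms(2))
  qed (use assms(1) in simp)
  then show ?thesis by (simp add: sum.cartesian_product case_prod_unfold)
qed

text \<open>By Pythagoras the energy gain is the squared L2 distance of the two averages;
  Cauchy-Schwarz turns it into an L1 bound.\<close>

lemma sum_abs_step_density_diff:
  assumes "finite V" "S \<subseteq> S'" and e: "energy V A S' - energy V A S \<le> \<epsilon>\<^sup>2 * (real (card V))\<^sup>2" "\<epsilon> \<ge> 0"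
  shows "(\<Sum>u\<in>V. \<Sum>v\<in>V. \<bar>step_density V A S' (u, v) - step_density V A S (u, v)\<bar>) \<le> \<epsilon> * (real (card V))\<^sup>2"
proof -
  let ?f = "\<lambda>x. step_density V A S' x - step_density V A S x" and ?n = "real (card V)"
  have "(\<Sum>x\<in>V \<times> V. \<bar>?f x\<bar>)\<^sup>2 \<le> (\<Sum>x\<in>V \<times> V. \<bar>?f x\<bar>\<^sup>2) * real (card (V \<times> V))"
    by (rule sum_squared_le_sum_of_squares)
  also have "(\<Sum>x\<in>V \<times> V. \<bar>?f x\<bar>\<^sup>2) = energy V A S' - energy V A S"
    unfolding energy_def step_density_def power2_abs
    by (rule sum_cond_avg_diff_squared) (use assms pair_key_mono in auto)
  also have "(energy V A S' - energy V A S) * real (card (V \<times> V)) \<le> (\<epsilon>\<^sup>2 * ?n\<^sup>2) * real (card (V \<times> V))"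
    by (intro mult_right_mono e) simp
  also have "\<dots> = (\<epsilon> * ?n\<^sup>2)\<^sup>2"
    by (simp add: card_cartesian_product power2_eq_square)
  finally have "(\<Sum>x\<in>V \<times> V. \<bar>?f x\<bar>) \<le> \<epsilon> * ?n\<^sup>2"
    by (rule power2_le_imp_le) (use e in auto)
  then show ?thesis by (simp add: sum.cartesian_product case_prod_unfold)
qed

text \<open>Energy increment: if every set of size at most \<open>k\<close> had a vertex gaining
  more than the tolerance, then \<open>k\<close> such insertions starting from the empty set would
  push the energy above its maximum.\<close>

lemma exists_stable_set:
  assumes V: "finite V" "V \<noteq> {}" and k: "real k * \<epsilon>\<^sup>2 > 1"
  shows "\<exists>S\<subseteq>V. card S \<le> k \<and> (\<forall>u\<in>V. energy V A (insert u S) - energy V A S \<le> \<epsilon>\<^sup>2 * (real (card V))\<^sup>2)"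
proof (rule ccontr)
  let ?n = "real (card V)"
  assume contra: "\<not> ?thesis"
  have "\<exists>S\<subseteq>V. card S \<le> m \<and> energy V A S \<ge> real m * (\<epsilon>\<^sup>2 * ?n\<^sup>2)" if "m \<le> k" for m
    using that
  proof (induction m)
    case 0
    then show ?case using energy_nonneg by (intro exI[of _ "{}"]) auto
  next
    case (Suc m)
    then obtain S where S: "S \<subseteq> V" "card S \<le> m" "energy V A S \<ge> real m * (\<epsilon>\<^sup>2 * ?n\<^sup>2)" by auto
    then obtain u where u: "u \<in> V" "energy V A (insert u S) - energy V A S > \<epsilon>\<^sup>2 * ?n\<^sup>2"
      by (metis Suc.prems Suc_leD contra le_trans not_le)
    have "card (insert u S) \<le> Suc m"
      using S card_insert_le_m1[of "Suc m" S u] by simp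
    moreover have "energy V A (insert u S) \<ge> real (Suc m) * (\<epsilon>\<^sup>2 * ?n\<^sup>2)"
      using S u by (simp add: algebra_simps)
    ultimately show ?case using S u by (intro exI[of _ "insert u S"]) auto
  qed
  from this[OF order_refl] obtain S where "energy V A S \<ge> real k * (\<epsilon>\<^sup>2 * ?n\<^sup>2)" by auto
  moreover have "real k * \<epsilon>\<^sup>2 * ?n\<^sup>2 > 1 * ?n\<^sup>2"
    using V k by (intro mult_strict_right_mono) (auto simp: card_gt_0_iff)
  ultimately show False using energy_le[OF V(1), of A S] by (simp add: mult.assoc)
qed

text \<open>The three factors \<open>step_density\<close> are replaced by \<open>A\<close> one at a time. The first replacement is
  exact; in the other two the remaining weight is constant on the classes of \<open>insert u S\<close> for a
  single vertex \<open>u\<close>, so the error is controlled by the energy gain of \<open>u\<close>.\<close>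

lemma step_density_triangles_le:
  assumes V: "finite V" and \<epsilon>: "\<epsilon> \<ge> 0"
    and stable: "\<And>u. u \<in> V \<Longrightarrow> energy V A (insert u S) - energy V A S \<le> \<epsilon>\<^sup>2 * (real (card V))\<^sup>2"
    and sym: "\<And>u v. A u v \<Longrightarrow> A v u"
    and free: "\<And>u v w. A u v \<Longrightarrow> A u w \<Longrightarrow> A v w \<Longrightarrow> False"
  defines "B \<equiv> \<lambda>u v. step_density V A S (u, v)"
  shows "(\<Sum>u\<in>V. \<Sum>v\<in>V. \<Sum>w\<in>V. B u v * B u w * B w v) \<le> 2 * \<epsilon> * real (card V) ^ 3"
proof -
  let ?n = "real (card V)" and ?a = "\<lambda>u v. of_bool (A u v) :: real"
  have B01: "0 \<le> B u v" "B u v \<le> 1" for u v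
    by (auto simp: B_def step_density_nonneg step_density_le_1)
  \<comment> \<open>\<open>B\<close> is first moved to the average for \<open>insert s S\<close>,
    which costs at most the L1 distance because \<open>F\<close> lies between 0 and 1. From there to
    adjacency nothing is lost, as \<open>F\<close> is constant on the finer classes.\<close>
  have swap: "(\<Sum>u\<in>V. \<Sum>v\<in>V. B u v * F u v) - (\<Sum>u\<in>V. \<Sum>v\<in>V. ?a u v * F u v) \<le> \<epsilon> * ?n\<^sup>2"
    if s: "s \<in> V" and F01: "\<And>u v. 0 \<le> F u v" "\<And>u v. F u v \<le> 1"
      and F: "\<And>u v u' v'. nbr_key A (insert s S) u = nbr_key A (insert s S) u' \<Longrightarrow>
         nbr_key A (insert s S) v = nbr_key A (insert s S) v' \<Longrightarrow> F u v = F u' v'" for F s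
  proof -
    let ?B' = "\<lambda>u v. step_density V A (insert s S) (u, v)"
    have eq: "(\<Sum>u\<in>V. \<Sum>v\<in>V. ?a u v * F u v) = (\<Sum>u\<in>V. \<Sum>v\<in>V. ?B' u v * F u v)"
      by (rule sum_step_density_mult[OF V F, symmetric])
    have "(\<Sum>u\<in>V. \<Sum>v\<in>V. B u v * F u v) - (\<Sum>u\<in>V. \<Sum>v\<in>V. ?a u v * F u v)
        = (\<Sum>u\<in>V. \<Sum>v\<in>V. (B u v - ?B' u v) * F u v)"
      unfolding eq by (simp add: sum_subtractf left_diff_distrib)
    also have "\<dots> \<le> (\<Sum>u\<in>V. \<Sum>v\<in>V. \<bar>?B' u v - B u v\<bar>)"
    proof (intro sum_mono)
      fix u v
      have "(B u v - ?B' u v) * F u v \<le> \<bar>?B' u v - B u v\<bar> * F u v"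
        by (intro mult_right_mono F01) auto
      also have "\<dots> \<le> \<bar>?B' u v - B u v\<bar> * 1"
        by (intro mult_left_mono F01) auto
      finally show "(B u v - ?B' u v) * F u v \<le> \<bar>?B' u v - B u v\<bar>" by simp
    qed
    also have "\<dots> \<le> \<epsilon> * ?n\<^sup>2"
      unfolding B_def using V stable[OF s] \<epsilon> by (intro sum_abs_step_density_diff) auto
    finally show ?thesis .
  qed
  have keyA: "A s u = A s u'" if "nbr_key A (insert s S) u = nbr_key A (insert s S) u'" for s u u'
    using that by (auto simp: nbr_key_def set_eq_iff)
  have keyB: "B u v = B u' v'" if "nbr_key A (insert s S) u = nbr_key A (insert s S) u'"
    "nbr_key A (insert s S) v = nbr_key A (insert s S) v'" for s u v u' v'
    unfolding B_def using that[THEN nbr_key_mono[OF subset_insertI]] by (rule step_density_cong)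
  have BF: "B u w * B w v = B u' w * B w v'" if "nbr_key A S u = nbr_key A S u'" "nbr_key A S v = nbr_key A S v'" for u v w u' v'
    unfolding B_def using step_density_cong[OF that(1) refl] step_density_cong[OF refl that(2)] by simp
  have "(\<Sum>u\<in>V. \<Sum>v\<in>V. \<Sum>w\<in>V. B u v * B u w * B w v) = (\<Sum>w\<in>V. \<Sum>u\<in>V. \<Sum>v\<in>V. B u v * (B u w * B w v))"
  proof -
    have "(\<Sum>u\<in>V. \<Sum>v\<in>V. \<Sum>w\<in>V. B u v * B u w * B w v) = (\<Sum>u\<in>V. \<Sum>w\<in>V. \<Sum>v\<in>V. B u v * (B u w * B w v))"
      unfolding mult.assoc by (intro sum.cong refl sum.swap)
    also have "\<dots> = (\<Sum>w\<in>V. \<Sum>u\<in>V. \<Sum>v\<in>V. B u v * (B u w * B w v))" by (rule sum.swap)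
    finally show ?thesis .
  qed
  \<comment> \<open>For fixed \<open>w\<close> the remaining weight depends only on the classes of
    \<open>u\<close> and \<open>v\<close> with respect to \<open>S\<close> itself, hence no error
    here.\<close>
  also have "\<dots> = (\<Sum>w\<in>V. \<Sum>u\<in>V. \<Sum>v\<in>V. ?a u v * (B u w * B w v))"
  proof (rule sum.cong[OF refl])
    fix w
    show "(\<Sum>u\<in>V. \<Sum>v\<in>V. B u v * (B u w * B w v)) = (\<Sum>u\<in>V. \<Sum>v\<in>V. ?a u v * (B u w * B w v))"
      unfolding B_def by (rule sum_step_density_mult[OF V]) (rule BF[unfolded B_def])
  qed
  also have "\<dots> = (\<Sum>u\<in>V. \<Sum>w\<in>V. \<Sum>v\<in>V. B w v * (?a u v * B u w))"
    by (subst sum.swap) (simp add: mult_ac)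
  \<comment> \<open>Now \<open>u\<close> is fixed: the key for \<open>insert u S\<close> shows
    adjacency to \<open>u\<close> and refines the classes that determine
    \<open>B u w\<close>.\<close>
  also have "\<dots> \<le> (\<Sum>u\<in>V. (\<Sum>w\<in>V. \<Sum>v\<in>V. ?a w v * (?a u v * B u w)) + \<epsilon> * ?n\<^sup>2)"
  proof (rule sum_mono)
    fix u assume u: "u \<in> V"
    have "(\<Sum>w\<in>V. \<Sum>v\<in>V. B w v * (?a u v * B u w)) - (\<Sum>w\<in>V. \<Sum>v\<in>V. ?a w v * (?a u v * B u w)) \<le> \<epsilon> * ?n\<^sup>2"
    proof (rule swap[OF u])
      fix w v w' v' assume "nbr_key A (insert u S) w = nbr_key A (insert u S) w'"
        "nbr_key A (insert u S) v = nbr_key A (insert u S) v'"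
      then show "?a u v * B u w = ?a u v' * B u w'"
        using keyA[of u v v'] keyB[of u u u w w'] by simp
    qed (use B01 in auto)
    then show "(\<Sum>w\<in>V. \<Sum>v\<in>V. B w v * (?a u v * B u w)) \<le> (\<Sum>w\<in>V. \<Sum>v\<in>V. ?a w v * (?a u v * B u w)) + \<epsilon> * ?n\<^sup>2"
      by simp
  qed
  also have "\<dots> = (\<Sum>u\<in>V. \<Sum>w\<in>V. \<Sum>v\<in>V. ?a w v * (?a u v * B u w)) + \<epsilon> * ?n ^ 3"
    by (simp add: sum.distrib power2_eq_square power3_eq_cube)
  \<comment> \<open>Symmetry of \<open>A\<close> turns the two replaced factors into adjacencies to
    \<open>v\<close>, so that \<open>v\<close> can serve as the single extra vertex.\<close>
  also have "(\<Sum>u\<in>V. \<Sum>w\<in>V. \<Sum>v\<in>V. ?a w v * (?a u v * B u w)) = (\<Sum>v\<in>V. \<Sum>u\<in>V. \<Sum>w\<in>V. B u w * (?a v u * ?a v w))"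
  proof -
    have "?a u v = ?a v u" for u v using sym by auto
    then have "?a w v * (?a u v * B u w) = B u w * (?a v u * ?a v w)" for u v w by (metis mult.assoc mult.commute)
    then have "(\<Sum>u\<in>V. \<Sum>w\<in>V. \<Sum>v\<in>V. ?a w v * (?a u v * B u w)) = (\<Sum>u\<in>V. \<Sum>w\<in>V. \<Sum>v\<in>V. B u w * (?a v u * ?a v w))"
      by (simp only:)
    also have "\<dots> = (\<Sum>u\<in>V. \<Sum>v\<in>V. \<Sum>w\<in>V. B u w * (?a v u * ?a v w))"
      by (intro sum.cong refl sum.swap)
    also have "\<dots> = (\<Sum>v\<in>V. \<Sum>u\<in>V. \<Sum>w\<in>V. B u w * (?a v u * ?a v w))" by (rule sum.swap)
    finally show ?thesis .
  qed
  also have "(\<Sum>v\<in>V. \<Sum>u\<in>V. \<Sum>w\<in>V. B u w * (?a v u * ?a v w))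
      \<le> (\<Sum>v\<in>V. (\<Sum>u\<in>V. \<Sum>w\<in>V. ?a u w * (?a v u * ?a v w)) + \<epsilon> * ?n\<^sup>2)"
  proof (rule sum_mono)
    fix v assume v: "v \<in> V"
    have "(\<Sum>u\<in>V. \<Sum>w\<in>V. B u w * (?a v u * ?a v w)) - (\<Sum>u\<in>V. \<Sum>w\<in>V. ?a u w * (?a v u * ?a v w)) \<le> \<epsilon> * ?n\<^sup>2"
    proof (rule swap[OF v])
      fix u w u' w' assume "nbr_key A (insert v S) u = nbr_key A (insert v S) u'"
        "nbr_key A (insert v S) w = nbr_key A (insert v S) w'"
      then show "?a v u * ?a v w = ?a v u' * ?a v w'"
        using keyA[of v u u'] keyA[of v w w'] by simp
    qed auto
    then show "(\<Sum>u\<in>V. \<Sum>w\<in>V. B u w * (?a v u * ?a v w)) \<le> (\<Sum>u\<in>V. \<Sum>w\<in>V. ?a u w * (?a v u * ?a v w)) + \<epsilon> * ?n\<^sup>2"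
      by simp
  qed
  \<comment> \<open>With all factors replaced, each term indicates a triangle of \<open>A\<close>
    and vanishes; only the accumulated error is left.\<close>
  also have "\<dots> = \<epsilon> * ?n ^ 3"
  proof -
    have z: "?a u w * (?a v u * ?a v w) = 0" for u v w using free[of v u w] by auto
    show ?thesis unfolding z by (simp add: power2_eq_square power3_eq_cube)
  qed
  finally show ?thesis by simp
qed

section \<open>Goodman's inequality for sets of ordered pairs\<close>

text \<open>For \<open>(u, v)\<close> in \<open>H\<close>, inclusion-exclusion gives at least
  \<open>a u + b v - card V\<close> vertices \<open>w\<close> completing a triangle, with
  \<open>a\<close> the out-degree and \<open>b\<close> the in-degree. Summing over \<open>H\<close>
  yields the two sums of squared degrees, which Cauchy-Schwarz bounds below.\<close>

lemma triangles_ge: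
  assumes V: "finite V" and H: "H \<subseteq> V \<times> V"
  defines "h \<equiv> \<lambda>u v. of_bool ((u, v) \<in> H) :: real"
  shows "real (card H) * (2 * real (card H) - (real (card V))\<^sup>2)
       \<le> real (card V) * (\<Sum>u\<in>V. \<Sum>v\<in>V. \<Sum>w\<in>V. h u v * h u w * h w v)"
proof -
  let ?n = "real (card V)" and ?m = "real (card H)"
  have m: "(\<Sum>u\<in>V. \<Sum>v\<in>V. h u v) = ?m"
  proof -
    have "(\<Sum>u\<in>V. \<Sum>v\<in>V. h u v) = (\<Sum>x\<in>V \<times> V. of_bool (x \<in> H))"
      by (simp add: h_def sum.cartesian_product case_prod_unfold)
    also have "\<dots> = real (card (V \<times> V \<inter> H))" using V by simp
    also have "V \<times> V \<inter> H = H" using H by blast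
    finally show ?thesis .
  qed
  define a b where "a u = (\<Sum>w\<in>V. h u w)" and "b v = (\<Sum>w\<in>V. h w v)" for u v
  have a: "(\<Sum>u\<in>V. a u) = ?m" using m by (simp add: a_def)
  have b: "(\<Sum>v\<in>V. b v) = ?m" using m by (simp add: b_def) (subst sum.swap, simp)
  have a2: "?m\<^sup>2 \<le> (\<Sum>u\<in>V. (a u)\<^sup>2) * ?n" and b2: "?m\<^sup>2 \<le> (\<Sum>v\<in>V. (b v)\<^sup>2) * ?n"
    using sum_squared_le_sum_of_squares[of a V] sum_squared_le_sum_of_squares[of b V] a b by auto
  have "(\<Sum>u\<in>V. \<Sum>v\<in>V. h u v * (a u + b v - ?n)) \<le> (\<Sum>u\<in>V. \<Sum>v\<in>V. \<Sum>w\<in>V. h u v * h u w * h w v)"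
  proof (intro sum_mono)
    fix u v
    have "h u v * (a u + b v - ?n) = (\<Sum>w\<in>V. h u v * (h u w + h w v - 1))"
      by (simp add: a_def b_def sum_distrib_left[symmetric] sum.distrib sum_subtractf)
    also have "\<dots> \<le> (\<Sum>w\<in>V. h u v * h u w * h w v)"
      by (intro sum_mono) (auto simp: h_def)
    finally show "h u v * (a u + b v - ?n) \<le> (\<Sum>w\<in>V. h u v * h u w * h w v)" .
  qed
  moreover have "(\<Sum>u\<in>V. \<Sum>v\<in>V. h u v * (a u + b v - ?n)) = (\<Sum>u\<in>V. (a u)\<^sup>2) + (\<Sum>v\<in>V. (b v)\<^sup>2) - ?n * ?m"
  proof -
    have "(\<Sum>u\<in>V. \<Sum>v\<in>V. h u v * a u) = (\<Sum>u\<in>V. (a u)\<^sup>2)"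
      by (simp add: sum_distrib_right[symmetric] a_def power2_eq_square)
    moreover have "(\<Sum>u\<in>V. \<Sum>v\<in>V. h u v * b v) = (\<Sum>v\<in>V. (b v)\<^sup>2)"
      by (subst sum.swap) (simp add: sum_distrib_right[symmetric] b_def power2_eq_square)
    moreover have "(\<Sum>u\<in>V. \<Sum>v\<in>V. h u v * ?n) = ?n * ?m"
      by (simp add: sum_distrib_right[symmetric] m)
    ultimately show ?thesis
      by (simp add: distrib_left right_diff_distrib sum.distrib sum_subtractf)
  qed
  ultimately have "?n * ((\<Sum>u\<in>V. (a u)\<^sup>2) + (\<Sum>v\<in>V. (b v)\<^sup>2) - ?n * ?m)
     \<le> ?n * (\<Sum>u\<in>V. \<Sum>v\<in>V. \<Sum>w\<in>V. h u v * h u w * h w v)"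
    by (intro mult_left_mono) auto
  then show ?thesis using a2 b2 by (simp add: algebra_simps power2_eq_square)
qed

section \<open>The container family and the container theorem\<close>

text \<open>Unions of class pairs, for arbitrary labellings of the vertices by subsets of a small
  \<open>S\<close>. No graph enters, so the family can be counted once for all graphs.\<close>

definition containers :: "'a set \<Rightarrow> nat \<Rightarrow> ('a \<times> 'a) set set" where
  "containers V k = (\<Union>S\<in>{S. S \<subseteq> V \<and> card S \<le> k}.
     (\<lambda>(\<kappa>, D). {(u, v) \<in> V \<times> V. (\<kappa> u, \<kappa> v) \<in> D}) ` ((V \<rightarrow>\<^sub>E Pow S) \<times> Pow (Pow S \<times> Pow S)))"

lemma finite_containers: "finite V \<Longrightarrow> finite (containers V k)"
  unfolding containers_def
  by (intro finite_UN_I finite_imageI finite_cartesian_product finite_PiE) (auto dest: finite_subset)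

text \<open>The factors count the sets \<open>S\<close>, the labellings, and the sets of label
  pairs. For fixed \<open>k\<close> the exponent of 2 is linear in \<open>card V\<close>.\<close>

lemma card_containers_le:
  assumes "finite V"
  shows "card (containers V k) \<le> 2 ^ card V * (2 ^ (k * card V) * 2 ^ (4 ^ k))"
proof -
  let ?I = "{S. S \<subseteq> V \<and> card S \<le> k}"
  have finI: "finite ?I" using assms by simp
  have "card (containers V k) \<le> (\<Sum>S\<in>?I. card ((\<lambda>(\<kappa>, D). {(u, v) \<in> V \<times> V. (\<kappa> u, \<kappa> v) \<in> D}) `
      ((V \<rightarrow>\<^sub>E Pow S) \<times> Pow (Pow S \<times> Pow S))))"
    unfolding containers_def by (rule card_UN_le[OF finI])
  also have "\<dots> \<le> (\<Sum>S\<in>?I. 2 ^ (k * card V) * 2 ^ (4 ^ k))"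
  proof (rule sum_mono)
    fix S assume "S \<in> ?I"
    then have S: "finite S" "card S \<le> k" using assms finite_subset by auto
    have "card ((\<lambda>(\<kappa>, D). {(u, v) \<in> V \<times> V. (\<kappa> u, \<kappa> v) \<in> D}) ` ((V \<rightarrow>\<^sub>E Pow S) \<times> Pow (Pow S \<times> Pow S)))
        \<le> card ((V \<rightarrow>\<^sub>E Pow S) \<times> Pow (Pow S \<times> Pow S))"
      by (rule card_image_le) (use S assms in \<open>auto intro!: finite_PiE\<close>)
    also have "\<dots> = (2 ^ card S) ^ card V * 2 ^ (2 ^ card S * 2 ^ card S)"
      using S assms by (simp add: card_cartesian_product card_PiE card_Pow)
    also have "\<dots> \<le> (2 ^ k) ^ card V * 2 ^ (2 ^ k * 2 ^ k)"
      using S by (intro mult_mono power_mono power_increasing) auto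
    also have "\<dots> = 2 ^ (k * card V) * 2 ^ (4 ^ k)"
      by (simp add: power_mult power_mult_distrib[symmetric])
    finally show "card ((\<lambda>(\<kappa>, D). {(u, v) \<in> V \<times> V. (\<kappa> u, \<kappa> v) \<in> D}) ` ((V \<rightarrow>\<^sub>E Pow S) \<times> Pow (Pow S \<times> Pow S)))
        \<le> 2 ^ (k * card V) * 2 ^ (4 ^ k)" .
  qed
  also have "\<dots> = card ?I * (2 ^ (k * card V) * 2 ^ (4 ^ k))" by simp
  also have "\<dots> \<le> 2 ^ card V * (2 ^ (k * card V) * 2 ^ (4 ^ k))"
  proof (rule mult_right_mono)
    show "card ?I \<le> 2 ^ card V"
      using card_mono[of "Pow V" ?I] assms by (auto simp: card_Pow)
  qed simp
  finally show ?thesis .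
qed

text \<open>The container consists of the class pairs of density above \<delta>. Stability with
  tolerance \<open>\<delta> ^ 4\<close> bounds the density-weighted triangles by
  \<open>2 * \<delta> ^ 4 * card V ^ 3\<close>; dividing by \<open>\<delta> ^ 3\<close> for the
  three dense factors leaves few enough triangles in \<open>H\<close> for Goodman's inequality.
  Pairs are ordered, hence the constant 1/2.\<close>

theorem triangle_free_container:
  assumes V: "finite V" "V \<noteq> {}" and \<delta>: "\<delta> > 0" and k: "real k * (\<delta> ^ 4)\<^sup>2 > 1"
    and sym: "\<And>u v. A u v \<Longrightarrow> A v u"
    and free: "\<And>u v w. A u v \<Longrightarrow> A u w \<Longrightarrow> A v w \<Longrightarrow> False"
  shows "\<exists>H\<in>containers V k. real (card {(u, v) \<in> V \<times> V. A u v \<and> (u, v) \<notin> H}) \<le> \<delta> * (real (card V))\<^sup>2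
    \<and> real (card H) \<le> (1 / 2 + 2 * \<delta>) * (real (card V))\<^sup>2"
proof -
  let ?n = "real (card V)"
  have n: "?n > 0" using V by (simp add: card_gt_0_iff)
  obtain S where S: "S \<subseteq> V" "card S \<le> k"
    and stable: "\<And>u. u \<in> V \<Longrightarrow> energy V A (insert u S) - energy V A S \<le> (\<delta> ^ 4)\<^sup>2 * ?n\<^sup>2"
    using exists_stable_set[OF V k, of A] by auto
  define B where "B u v = step_density V A S (u, v)" for u v
  have B0: "0 \<le> B u v" for u v by (simp add: B_def step_density_nonneg)
  define H where "H = {(u, v) \<in> V \<times> V. B u v > \<delta>}"
  have HV: "H \<subseteq> V \<times> V" by (auto simp: H_def)
  have "H \<in> containers V k"
  proof -
    define D where "D = (\<lambda>(u, v). (nbr_key A S u, nbr_key A S v)) ` H"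
    have "H = {(u, v) \<in> V \<times> V. (restrict (nbr_key A S) V u, restrict (nbr_key A S) V v) \<in> D}"
    proof (intro equalityI subsetI)
      fix x assume "x \<in> {(u, v) \<in> V \<times> V. (restrict (nbr_key A S) V u, restrict (nbr_key A S) V v) \<in> D}"
      then obtain u v u' v' where x: "x = (u, v)" "u \<in> V" "v \<in> V" "(u', v') \<in> H"
        "nbr_key A S u = nbr_key A S u'" "nbr_key A S v = nbr_key A S v'"
        by (auto simp: D_def)
      then have "B u v = B u' v'" unfolding B_def by (intro step_density_cong)
      then show "x \<in> H" using x by (simp add: H_def)
    qed (auto simp: D_def H_def)
    moreover have "restrict (nbr_key A S) V \<in> V \<rightarrow>\<^sub>E Pow S" "D \<subseteq> Pow S \<times> Pow S"
      by (auto simp: nbr_key_def D_def)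
    ultimately show ?thesis unfolding containers_def using S by blast
  qed
  moreover have "real (card {(u, v) \<in> V \<times> V. A u v \<and> (u, v) \<notin> H}) \<le> \<delta> * ?n\<^sup>2"
  proof -
    have "real (card {(u, v) \<in> V \<times> V. A u v \<and> (u, v) \<notin> H})
        = (\<Sum>x\<in>V \<times> V. of_bool (case x of (u, v) \<Rightarrow> A u v \<and> (u, v) \<notin> H))"
      using V by (simp add: Int_def case_prod_unfold mem_Times_iff conj_assoc)
    also have "\<dots> = (\<Sum>u\<in>V. \<Sum>v\<in>V. of_bool (A u v) * of_bool (B u v \<le> \<delta>))"
      unfolding sum.cartesian_product by (rule sum.cong) (auto simp: H_def)
    \<comment> \<open>Being sparse is a property of class pairs, so adjacency may be exchanged for
      the density, which is at most \<delta> there.\<close>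
    also have "\<dots> = (\<Sum>u\<in>V. \<Sum>v\<in>V. B u v * of_bool (B u v \<le> \<delta>))"
      unfolding B_def by (rule sum_step_density_mult[symmetric, OF V(1)]) (metis step_density_cong)
    also have "\<dots> \<le> (\<Sum>u\<in>V. \<Sum>v\<in>V. \<delta>)" using \<delta> by (intro sum_mono) auto
    also have "\<dots> = \<delta> * ?n\<^sup>2" by (simp add: power2_eq_square)
    finally show ?thesis .
  qed
  moreover have "real (card H) \<le> (1 / 2 + 2 * \<delta>) * ?n\<^sup>2"
  proof (rule ccontr)
    let ?m = "real (card H)"
    define T where "T = (\<Sum>u\<in>V. \<Sum>v\<in>V. \<Sum>w\<in>V. of_bool ((u, v) \<in> H) * of_bool ((u, w) \<in> H) * of_bool ((w, v) \<in> H) :: real)"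
    have "\<delta> ^ 3 * T \<le> (\<Sum>u\<in>V. \<Sum>v\<in>V. \<Sum>w\<in>V. B u v * B u w * B w v)"
      unfolding T_def sum_distrib_left
    proof (intro sum_mono)
      fix u v w
      have "\<delta> * of_bool ((u, v) \<in> H) \<le> B u v" for u v using B0 by (auto simp: H_def less_imp_le)
      then have "\<delta> * of_bool ((u, v) \<in> H) * (\<delta> * of_bool ((u, w) \<in> H)) * (\<delta> * of_bool ((w, v) \<in> H)) \<le> B u v * B u w * B w v"
        using \<delta> B0 by (intro mult_mono) auto
      then show "\<delta> ^ 3 * (of_bool ((u, v) \<in> H) * of_bool ((u, w) \<in> H) * of_bool ((w, v) \<in> H)) \<le> B u v * B u w * B w v"
        by (simp add: power3_eq_cube mult_ac)
    qed
    also have "\<dots> \<le> 2 * \<delta> ^ 4 * ?n ^ 3"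
      unfolding B_def by (rule step_density_triangles_le) (use V \<delta> stable sym free in auto)
    also have "\<dots> = \<delta> ^ 3 * (2 * \<delta> * ?n ^ 3)" by (simp add: power_eq_if)
    finally have T: "T \<le> 2 * \<delta> * ?n ^ 3" using \<delta> by simp
    have ge: "?m * (2 * ?m - ?n\<^sup>2) \<le> ?n * T"
      unfolding T_def by (rule triangles_ge[OF V(1) HV])
    assume "\<not> ?m \<le> (1 / 2 + 2 * \<delta>) * ?n\<^sup>2"
    then have m: "?m > ?n\<^sup>2 / 2 + 2 * \<delta> * ?n\<^sup>2" by (simp add: algebra_simps)
    moreover have d: "\<delta> * ?n\<^sup>2 > 0" using \<delta> n by simp
    moreover have "?m > 0" using m d zero_le_power2[of ?n] by linarith
    \<comment> \<open>An excess above \<open>2 * \<delta> * (card V)\<^sup>2\<close> makes the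
      factor \<open>2 * ?m - ?n\<^sup>2\<close> exceed \<open>4 * \<delta> * ?n\<^sup>2\<close>; the
      product then equals exactly the upper bound for \<open>?n * T\<close>, so strictness gives the
      contradiction.\<close>
    ultimately have "(?n\<^sup>2 / 2) * (4 * \<delta> * ?n\<^sup>2) < ?m * (2 * ?m - ?n\<^sup>2)"
      using n by (intro mult_strict_mono) auto
    also note ge
    also have "?n * T \<le> ?n * (2 * \<delta> * ?n ^ 3)" using T n by (intro mult_left_mono) auto
    also have "\<dots> = (?n\<^sup>2 / 2) * (4 * \<delta> * ?n\<^sup>2)" by (simp add: power2_eq_square power3_eq_cube)
    finally show False by simp
  qed
  ultimately show ?thesis by blast
qed


subsection \<open>Counting DK3-free digraphs\<close>

lemma card_K_edges: "card (K_edges n) = n choose 2"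
  using n_subsets[of "{1..n}" 2] by (simp add: K_edges_def)

lemma choose_two_le_square: "real (n choose 2) \<le> (real n)\<^sup>2"
proof -
  have "n choose 2 \<le> n\<^sup>2"
    unfolding choose_two power2_eq_square by (meson div_le_dividend diff_le_self le_trans mult_le_mono2)
  then show ?thesis by (metis of_nat_mono of_nat_power)
qed

lemma card_DK3_free_digraphs: "card (DK3_free_digraphs n) = card (DK3_free n)"
proof -
  have "inj_on (encode n) (DK3_free_digraphs n)"
    using bij_betw_imp_inj_on[OF bij_betw_encode] by (rule inj_on_subset) (auto simp: DK3_free_digraphs_def)
  then show ?thesis unfolding DK3_free_def by (rule card_image[symmetric])
qed

lemma finite_DK3_free: "finite (DK3_free n)"
  by (rule finite_subset[of _ "colourings n"]) (auto simp: DK3_free_eq colourings_def intro!: finite_PiE)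

lemma card_realisations:
  assumes "t \<in> templates n"
  shows "real (card (realisations n t)) = 4 powr Ent n t"
proof -
  have "real (card (t e)) = 4 powr log 4 (real (card (t e)))" if "e \<in> K_edges n" for e
  proof -
    have "t e \<noteq> {}" "t e \<subseteq> {1..4}" using assms that by (auto simp: templates_def)
    then have "card (t e) > 0" by (meson card_gt_0_iff finite_atLeastAtMost finite_subset)
    then show ?thesis by simp
  qed
  then have "(\<Prod>e\<in>K_edges n. real (card (t e))) = (\<Prod>e\<in>K_edges n. 4 powr log 4 (real (card (t e))))"
    by (rule prod.cong[OF refl])
  then show ?thesis
    unfolding realisations_def Ent_def by (simp add: card_PiE powr_sum)
qed

text \<open>All realisations of an optimal template are \<open>DK3\<close>-free colourings.\<close>

lemma ex_le_card: "4 powr ex DK3_free n \<le> real (card (DK3_free n))"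
proof -
  obtain t where t: "DK3_free_template n t" "Ent n t = ex DK3_free n" by (rule ex_attained)
  then have "4 powr ex DK3_free n = real (card (realisations n t))"
    by (simp add: card_realisations DK3_free_template_def)
  also have "\<dots> \<le> real (card (DK3_free n))"
    using t by (auto simp: DK3_free_template_def intro!: card_mono finite_DK3_free)
  finally show ?thesis .
qed

section \<open>Edge templates and the bipartite lower bound\<close>

text \<open>Colour 4 encodes a double edge, so \<open>F\<close> is the graph of potential double
  edges and all other pairs keep the three remaining states.\<close>

definition edge_template :: "nat \<Rightarrow> nat set set \<Rightarrow> nat set \<Rightarrow> nat set" where
  "edge_template n F = (\<lambda>e\<in>K_edges n. if e \<in> F then {1..4} else {1..3})"

lemma edge_template_templates: "edge_template n F \<in> templates n"
  by (auto simp: edge_template_def templates_def)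

lemma Ent_edge_template:
  assumes "F \<subseteq> K_edges n"
  shows "Ent n (edge_template n F) = real (card F) + (real (n choose 2) - real (card F)) * log 4 3"
proof -
  have "Ent n (edge_template n F) = (\<Sum>e\<in>K_edges n. if e \<in> F then 1 else log 4 3)"
    unfolding Ent_def edge_template_def by (rule sum.cong) auto
  also have "\<dots> = real (card F) + real (card (K_edges n - F)) * log 4 3"
    using assms by (simp add: sum.If_cases Int_absorb1 Diff_eq)
  also have "real (card (K_edges n - F)) = real (n choose 2) - real (card F)"
    using assms card_mono[OF finite_K_edges assms]
    by (simp add: card_Diff_subset finite_subset card_K_edges of_nat_diff)
  finally show ?thesis .
qed

text \<open>The base-4 logarithm of the main term of the closed form.\<close>

definition turan_entropy :: "nat \<Rightarrow> real" where
  "turan_entropy n = real (n\<^sup>2 div 4) + (real (n choose 2) - real (n\<^sup>2 div 4)) * log 4 3"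

text \<open>The balanced complete bipartite graph, between the lower and the upper half of the
  vertices.\<close>

definition turan_edges :: "nat \<Rightarrow> nat set set" where
  "turan_edges n = (\<lambda>(i, j). {i, j}) ` ({1..n div 2} \<times> {n div 2<..n})"

lemma half_times_half: "(n div 2) * (n - n div 2) = n\<^sup>2 div (4 :: nat)"
proof (cases "even n")
  case True
  then obtain m where "n = 2 * m" by (rule evenE)
  then show ?thesis by (simp add: power2_eq_square)
next
  case False
  then obtain m where n: "n = 2 * m + 1" by (rule oddE)
  have "n\<^sup>2 = 4 * (m * (m + 1)) + 1" by (simp add: n power2_eq_square algebra_simps)
  moreover have "(4 * q + 1) div 4 = q" for q :: nat by simp
  ultimately have "n\<^sup>2 div 4 = m * (m + 1)" by simp
  then show ?thesis by (simp add: n)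
qed

lemma card_turan_edges: "card (turan_edges n) = n\<^sup>2 div 4"
proof -
  have "inj_on (\<lambda>(i, j). {i, j}) ({1..n div 2} \<times> {n div 2<..n})"
    by (auto simp: inj_on_def doubleton_eq_iff)
  then show ?thesis
    unfolding turan_edges_def by (simp add: card_image card_cartesian_product half_times_half)
qed

lemma turan_edges_subset: "turan_edges n \<subseteq> K_edges n"
  by (auto simp: turan_edges_def doubleton_K_edges)

lemma turan_edges_iff:
  "{i, j} \<in> turan_edges n \<longleftrightarrow> i \<in> {1..n} \<and> j \<in> {1..n} \<and> (i \<le> n div 2 \<longleftrightarrow> \<not> j \<le> n div 2)"
  by (auto simp: turan_edges_def doubleton_eq_iff image_iff)

text \<open>Two of any three vertices lie in the same half, and the pair they form cannot take
  colour 4.\<close>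

lemma turan_entropy_le_ex: "turan_entropy n \<le> ex DK3_free n"
proof -
  have "DK3_free_template n (edge_template n (turan_edges n))"
    unfolding DK3_free_template_iff
  proof (intro conjI edge_template_templates notI, elim bexE conjE)
    fix i j k assume "i \<in> {1..n}" "j \<in> {1..n}" "k \<in> {1..n}" "i \<noteq> j" "i \<noteq> k" "j \<noteq> k"
      and "4 \<in> edge_template n (turan_edges n) {i, j}" "4 \<in> edge_template n (turan_edges n) {i, k}"
        "4 \<in> edge_template n (turan_edges n) {j, k}"
    then have "{i, j} \<in> turan_edges n" "{i, k} \<in> turan_edges n" "{j, k} \<in> turan_edges n"
      by (auto simp: edge_template_def doubleton_K_edges split: if_splits)
    then show False by (auto simp: turan_edges_iff)
  qed
  from Ent_le_ex[OF this] show ?thesis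
    by (simp add: Ent_edge_template turan_edges_subset card_turan_edges turan_entropy_def)
qed

section \<open>From containers of ordered pairs to templates\<close>

lemma card_ordered_pairs:
  assumes "E \<subseteq> K_edges n"
  shows "card {(u, v). u \<noteq> v \<and> {u, v} \<in> E} = 2 * card E"
proof -
  let ?P = "\<lambda>e. {(u, v). u \<noteq> v \<and> {u, v} = e}"
  have P: "card (?P e) = 2 \<and> finite (?P e)" if "e \<in> E" for e
  proof -
    from that assms obtain i j where "e = {i, j}" "i < j" by (meson K_edgesE subsetD)
    then have "?P e = {(i, j), (j, i)}" "(i, j) \<noteq> (j, i)" by (auto simp: doubleton_eq_iff)
    then show ?thesis by simp
  qed
  have "card (\<Union>e\<in>E. ?P e) = (\<Sum>e\<in>E. card (?P e))"
    using assms P by (intro card_UN_disjoint) (auto intro: finite_subset)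
  also have "\<dots> = 2 * card E" using P by simp
  also have "(\<Union>e\<in>E. ?P e) = {(u, v). u \<noteq> v \<and> {u, v} \<in> E}" by auto
  finally show ?thesis .
qed

text \<open>A container may hold only one orientation of a pair. Requiring both gives at most
  \<open>card H / 2\<close> edges, and any other edge has an orientation outside
  \<open>H\<close>.\<close>

definition symmetric_edges :: "nat \<Rightarrow> (nat \<times> nat) set \<Rightarrow> nat set set" where
  "symmetric_edges n H = {e \<in> K_edges n. \<forall>u\<in>e. \<forall>v\<in>e. u \<noteq> v \<longrightarrow> (u, v) \<in> H}"

lemma card_symmetric_edges:
  assumes "finite H"
  shows "2 * card (symmetric_edges n H) \<le> card H"
proof -
  have "2 * card (symmetric_edges n H) = card {(u, v). u \<noteq> v \<and> {u, v} \<in> symmetric_edges n H}"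
    by (rule card_ordered_pairs[symmetric, of _ n]) (auto simp: symmetric_edges_def)
  also have "\<dots> \<le> card H"
    by (rule card_mono[OF assms]) (auto simp: symmetric_edges_def)
  finally show ?thesis .
qed

text \<open>The container theorem is applied to the triangle-free graph of colour-4 edges;
  \<open>R\<close> collects those that the container misses. Half of
  \<open>1 / 2 + 2 * \<delta>\<close> for the symmetric part plus \<delta> for \<open>R\<close>
  gives \<open>1 / 4 + 2 * \<delta>\<close>.\<close>

lemma colouring_container:
  assumes c: "c \<in> DK3_free n" and n: "n > 0" and \<delta>: "\<delta> > 0" and k: "real k * (\<delta> ^ 4)\<^sup>2 > 1"
  obtains H R where "H \<in> containers {1..n} k" "R \<subseteq> K_edges n" "real (card R) \<le> \<delta> * (real n)\<^sup>2"
    "real (card (symmetric_edges n H \<union> R)) \<le> (1 / 4 + 2 * \<delta>) * (real n)\<^sup>2"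
    "c \<in> realisations n (edge_template n (symmetric_edges n H \<union> R))"
proof -
  let ?V = "{1..n}"
  define A where "A u v \<longleftrightarrow> u \<in> ?V \<and> v \<in> ?V \<and> u \<noteq> v \<and> c {u, v} = 4" for u v
  have sym: "A v u" if "A u v" for u v
    using that by (auto simp: A_def insert_commute)
  have free: False if "A u v" "A u w" "A v w" for u v w
    using that c unfolding A_def DK3_free_eq by blast
  obtain H where H: "H \<in> containers ?V k"
    and out: "real (card {(u, v) \<in> ?V \<times> ?V. A u v \<and> (u, v) \<notin> H}) \<le> \<delta> * (real n)\<^sup>2"
    and cH: "real (card H) \<le> (1 / 2 + 2 * \<delta>) * (real n)\<^sup>2"
  proof -
    have "\<exists>H\<in>containers ?V k. real (card {(u, v) \<in> ?V \<times> ?V. A u v \<and> (u, v) \<notin> H}) \<le> \<delta> * (real (card ?V))\<^sup>2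
      \<and> real (card H) \<le> (1 / 2 + 2 * \<delta>) * (real (card ?V))\<^sup>2"
    proof (rule triangle_free_container[OF _ _ \<delta> k])
      show "?V \<noteq> {}" using n by simp
    qed (fact finite_atLeastAtMost sym free)+
    then show thesis using that by auto
  qed
  let ?X = "{(u, v) \<in> ?V \<times> ?V. A u v \<and> (u, v) \<notin> H}"
  define R where "R = {e \<in> K_edges n. c e = 4} - symmetric_edges n H"
  have finX: "finite ?X" by (rule finite_subset[of _ "?V \<times> ?V"]) auto
  \<comment> \<open>Each missed edge has an orientation outside \<open>H\<close>, which lies in
    \<open>?X\<close> since \<open>A\<close> holds in both orientations.\<close>
  have "R \<subseteq> (\<lambda>(u, v). {u, v}) ` ?X"
  proof
    fix e assume e: "e \<in> R"
    then obtain u v where uv: "u \<in> e" "v \<in> e" "u \<noteq> v" "(u, v) \<notin> H"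
      by (auto simp: R_def symmetric_edges_def)
    have "e \<in> K_edges n" using e by (simp add: R_def)
    then have "e = {u, v}" using uv by (elim K_edgesE) auto
    moreover have "c e = 4" using e by (simp add: R_def)
    ultimately have "(u, v) \<in> ?X" using uv \<open>e \<in> K_edges n\<close> by (auto simp: A_def doubleton_K_edges)
    then show "e \<in> (\<lambda>(u, v). {u, v}) ` ?X" using \<open>e = {u, v}\<close> by force
  qed
  then have "card R \<le> card ?X" using finX by (rule surj_card_le[rotated])
  then have cR: "real (card R) \<le> \<delta> * (real n)\<^sup>2" using out by linarith
  have "finite H"
  proof (rule finite_subset)
    show "H \<subseteq> ?V \<times> ?V" using H by (auto simp: containers_def)
  qed simp
  then have "2 * real (card (symmetric_edges n H)) \<le> (1 / 2 + 2 * \<delta>) * (real n)\<^sup>2"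
    using card_symmetric_edges[of H n] cH by linarith
  moreover have "real (card (symmetric_edges n H \<union> R)) \<le> real (card (symmetric_edges n H)) + real (card R)"
    using card_Un_le[of "symmetric_edges n H" R] by linarith
  ultimately have cU: "real (card (symmetric_edges n H \<union> R)) \<le> (1 / 4 + 2 * \<delta>) * (real n)\<^sup>2"
    using cR by (simp add: algebra_simps)
  have "c \<in> realisations n (edge_template n (symmetric_edges n H \<union> R))"
    unfolding realisations_def
  proof (rule PiE_I)
    fix e assume e: "e \<in> K_edges n"
    have "c e \<in> {1..4}" using c e by (auto simp: DK3_free_eq colourings_def)
    moreover have "c e = 4 \<Longrightarrow> e \<in> symmetric_edges n H \<union> R" using e by (simp add: R_def)
    ultimately show "c e \<in> edge_template n (symmetric_edges n H \<union> R) e"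
      using e by (cases "c e = 4") (auto simp: edge_template_def)
  next
    fix e assume "e \<notin> K_edges n"
    then show "c e = undefined" using c by (auto simp: DK3_free_eq colourings_def)
  qed
  then show thesis using that[OF H _ cR cU] by (auto simp: R_def)
qed

section \<open>Upper bound for the number of colourings\<close>

text \<open>Exponential weighting: \<open>\<delta> powr (card R - m)\<close> is at least 1 on the
  sets counted, and its sum over all subsets of \<open>E\<close> factorises by the binomial
  expansion of \<open>(1 + \<delta>) ^ card E\<close>.\<close>

lemma card_small_subsets_le:
  fixes \<delta> m :: real
  assumes "finite E" "0 < \<delta>" "\<delta> \<le> 1"
  shows "real (card {R. R \<subseteq> E \<and> real (card R) \<le> m}) \<le> exp (m * ln (1 / \<delta>) + \<delta> * real (card E))"
proof -
  let ?S = "{R. R \<subseteq> E \<and> real (card R) \<le> m}"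
  have "real (card ?S) = (\<Sum>R\<in>?S. 1)" by simp
  also have "\<dots> \<le> (\<Sum>R\<in>?S. exp (m * ln (1 / \<delta>)) * \<delta> ^ card R)"
  proof (rule sum_mono)
    fix R assume "R \<in> ?S"
    then have "real (card R) * ln (1 / \<delta>) \<le> m * ln (1 / \<delta>)"
      using assms by (intro mult_right_mono) auto
    then have "0 \<le> m * ln (1 / \<delta>) + real (card R) * ln \<delta>" using assms by (simp add: ln_div)
    then have "1 \<le> exp (m * ln (1 / \<delta>) + real (card R) * ln \<delta>)" by simp
    also have "\<dots> = exp (m * ln (1 / \<delta>)) * \<delta> ^ card R"
      using assms by (simp add: exp_add exp_of_nat_mult)
    finally show "1 \<le> exp (m * ln (1 / \<delta>)) * \<delta> ^ card R" .
  qed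
  also have "\<dots> \<le> (\<Sum>R\<in>Pow E. exp (m * ln (1 / \<delta>)) * \<delta> ^ card R)"
    using assms by (intro sum_mono2) auto
  also have "\<dots> = exp (m * ln (1 / \<delta>)) * (1 + \<delta>) ^ card E"
    using prod_add[OF assms(1), of "\<lambda>_. \<delta>" "\<lambda>_. 1"] by (simp add: sum_distrib_left add.commute)
  also have "\<dots> \<le> exp (m * ln (1 / \<delta>)) * exp \<delta> ^ card E"
    using assms by (intro mult_left_mono power_mono exp_ge_add_one_self) auto
  also have "\<dots> = exp (m * ln (1 / \<delta>) + \<delta> * real (card E))"
    by (simp add: exp_add exp_of_nat_mult[symmetric] mult.commute)
  finally show ?thesis .
qed

text \<open>A union bound over pairs \<open>(H, R)\<close>. The three groups of terms come from the
  number of containers, the number of remainder sets, and the realisations of one template.\<close>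

lemma card_DK3_free_le:
  assumes n: "n > 0" and \<delta>: "\<delta> > 0" "\<delta> \<le> 1" and k: "real k * (\<delta> ^ 4)\<^sup>2 > 1"
  shows "ln (real (card (DK3_free n))) \<le> ln 2 * (real (Suc k) * real n + 4 ^ k)
    + (\<delta> * ln (1 / \<delta>) + \<delta>) * (real n)\<^sup>2
    + (real (n choose 2) * ln 3 + (1 / 4 + 2 * \<delta>) * (real n)\<^sup>2 * ln (4 / 3))"
proof -
  let ?C = "containers {1..n} k" and ?S = "{R. R \<subseteq> K_edges n \<and> real (card R) \<le> \<delta> * (real n)\<^sup>2}"
  let ?U = "\<lambda>(H, R). symmetric_edges n H \<union> R"
  let ?M = "(1 / 4 + 2 * \<delta>) * (real n)\<^sup>2"
  let ?b = "exp (real (n choose 2) * ln 3 + ?M * ln (4 / 3))"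
  \<comment> \<open>The size condition on the union is kept in the index set, because it bounds the
    realisations of each template; it is dropped when the index set itself is counted.\<close>
  define I where "I = {x \<in> ?C \<times> ?S. real (card (?U x)) \<le> ?M}"
  have finC: "finite ?C" by (simp add: finite_containers)
  have finS: "finite ?S" by (rule finite_subset[of _ "Pow (K_edges n)"]) auto
  have finI: "finite I" unfolding I_def using finC finS by simp
  have sub: "DK3_free n \<subseteq> (\<Union>x\<in>I. realisations n (edge_template n (?U x)))"
  proof
    fix c assume "c \<in> DK3_free n"
    then obtain H R where "H \<in> ?C" "R \<subseteq> K_edges n" "real (card R) \<le> \<delta> * (real n)\<^sup>2"
      "real (card (symmetric_edges n H \<union> R)) \<le> ?M"
      "c \<in> realisations n (edge_template n (symmetric_edges n H \<union> R))"
      using colouring_container[OF _ n \<delta>(1) k] by metis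
    then have "(H, R) \<in> I \<and> c \<in> realisations n (edge_template n (?U (H, R)))" by (simp add: I_def)
    then show "c \<in> (\<Union>x\<in>I. realisations n (edge_template n (?U x)))" by blast
  qed
  have real_le: "real (card (realisations n (edge_template n (?U x)))) \<le> ?b" if x: "x \<in> I" for x
  proof -
    have U: "?U x \<subseteq> K_edges n" using x by (auto simp: I_def symmetric_edges_def)
    have "real (card (realisations n (edge_template n (?U x))))
        = exp (ln 4 * (real (card (?U x)) + (real (n choose 2) - real (card (?U x))) * log 4 3))"
      by (simp add: card_realisations edge_template_templates Ent_edge_template[OF U] powr_def mult.commute)
    \<comment> \<open>Each pair contributes a factor 3, raised to 4 on the potential double
      edges.\<close>
    also have "ln 4 * (real (card (?U x)) + (real (n choose 2) - real (card (?U x))) * log 4 3)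
        = real (n choose 2) * ln 3 + real (card (?U x)) * ln (4 / 3)"
      by (simp add: log_def ln_div field_simps)
    also have "exp \<dots> \<le> ?b"
      using x by (auto simp: I_def intro!: mult_right_mono)
    finally show ?thesis .
  qed
  have fin_real: "finite (realisations n (edge_template n F))" for F
    unfolding realisations_def by (rule finite_PiE) (auto simp: edge_template_def)
  have "real (card (DK3_free n)) \<le> real (card (\<Union>x\<in>I. realisations n (edge_template n (?U x))))"
    using sub finI fin_real by (intro of_nat_mono card_mono) auto
  also have "\<dots> \<le> real (\<Sum>x\<in>I. card (realisations n (edge_template n (?U x))))"
    by (intro of_nat_mono card_UN_le finI)
  also have "\<dots> = (\<Sum>x\<in>I. real (card (realisations n (edge_template n (?U x)))))" by simp
  also have "\<dots> \<le> real (card I) * ?b" by (rule sum_bounded_above) (rule real_le)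
  also have "\<dots> \<le> (real (card ?C) * real (card ?S)) * ?b"
  proof (rule mult_right_mono)
    have "card I \<le> card (?C \<times> ?S)" unfolding I_def using finC finS by (intro card_mono) auto
    then show "real (card I) \<le> real (card ?C) * real (card ?S)"
      by (simp add: card_cartesian_product flip: of_nat_mult)
  qed simp
  also have "\<dots> \<le> (exp (ln 2 * (real (Suc k) * real n + 4 ^ k)) * exp ((\<delta> * ln (1 / \<delta>) + \<delta>) * (real n)\<^sup>2)) * ?b"
  proof (intro mult_right_mono mult_mono)
    have "card ?C \<le> 2 ^ (n + k * n + 4 ^ k)"
      using card_containers_le[of "{1..n}" k] by (simp add: power_add mult.assoc)
    then have "real (card ?C) \<le> real (2 ^ (n + k * n + 4 ^ k))" by (rule of_nat_mono)
    also have "\<dots> = exp (real (n + k * n + 4 ^ k) * ln 2)" by (simp only: exp_of_nat_mult) simp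
    also have "real (n + k * n + 4 ^ k) * ln 2 = ln 2 * (real (Suc k) * real n + 4 ^ k)"
      by (simp add: algebra_simps)
    finally show "real (card ?C) \<le> exp (ln 2 * (real (Suc k) * real n + 4 ^ k))" .
  next
    have "real (card ?S) \<le> exp (\<delta> * (real n)\<^sup>2 * ln (1 / \<delta>) + \<delta> * real (card (K_edges n)))"
      by (rule card_small_subsets_le) (use \<delta> in auto)
    also have "\<dots> \<le> exp ((\<delta> * ln (1 / \<delta>) + \<delta>) * (real n)\<^sup>2)"
    proof -
      have "real (card (K_edges n)) \<le> (real n)\<^sup>2" unfolding card_K_edges by (rule choose_two_le_square)
      then have "\<delta> * real (card (K_edges n)) \<le> \<delta> * (real n)\<^sup>2" using \<delta> by simp
      then show ?thesis by (simp add: algebra_simps)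
    qed
    finally show "real (card ?S) \<le> exp ((\<delta> * ln (1 / \<delta>) + \<delta>) * (real n)\<^sup>2)" .
  qed auto
  also have "\<dots> = exp (ln 2 * (real (Suc k) * real n + 4 ^ k) + (\<delta> * ln (1 / \<delta>) + \<delta>) * (real n)\<^sup>2
    + (real (n choose 2) * ln 3 + ?M * ln (4 / 3)))"
    by (simp only: exp_add)
  finally have *: "real (card (DK3_free n)) \<le> \<dots>" .
  have "real (card (DK3_free n)) > 0"
    using ex_le_card[of n] powr_gt_zero[of 4 "ex DK3_free n"] by linarith
  from ln_mono[OF * this] show ?thesis by simp
qed

section \<open>Asymptotics\<close>

text \<open>First \<delta> is fixed to make the quadratic error small, then \<open>k\<close>
  depending on \<delta>, and only then is \<open>n\<close> taken large enough to absorb the linear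
  container count.\<close>

lemma log_card_excess:
  assumes \<gamma>: "\<gamma> > 0"
  shows "\<forall>\<^sub>F n in sequentially. log 4 (real (card (DK3_free n))) - turan_entropy n \<le> \<gamma> * (real n)\<^sup>2"
proof -
  \<comment> \<open>Taking \<open>\<delta> = \<rho>\<^sup>2\<close> gives
    \<open>\<delta> * ln (1 / \<delta>) \<le> 2 * \<rho>\<close>. With three further terms \<delta>,
    each at most \<rho>, the total is at most \<open>5 * \<rho>\<close>, hence the divisor
    10.\<close>
  define \<rho> where "\<rho> = min 1 (\<gamma> / 10)"
  define \<delta> where "\<delta> = \<rho>\<^sup>2"
  have \<rho>: "0 < \<rho>" "\<rho> \<le> 1" "\<rho> \<le> \<gamma> / 10" using \<gamma> by (auto simp: \<rho>_def)
  then have \<delta>: "0 < \<delta>" "\<delta> \<le> 1" "\<delta> \<le> \<rho>"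
    by (auto simp: \<delta>_def power_le_one mult_left_le power2_eq_square[of \<rho>] mult_le_one)
  obtain k where "real k > 1 / (\<delta> ^ 4)\<^sup>2" using reals_Archimedean2 by blast
  then have k: "real k * (\<delta> ^ 4)\<^sup>2 > 1" using \<delta> by (simp add: field_simps)
  have "\<delta> * ln (1 / \<delta>) \<le> 2 * \<rho>"
  proof -
    have "ln (1 / \<rho>) \<le> 1 / \<rho>" using \<rho> ln_le_minus_one[of "1 / \<rho>"] by simp
    then have "\<delta> * (2 * ln (1 / \<rho>)) \<le> \<delta> * (2 * (1 / \<rho>))"
      using \<delta> by (intro mult_left_mono) auto
    moreover have "ln (1 / \<delta>) = 2 * ln (1 / \<rho>)" using \<rho> by (simp add: \<delta>_def ln_div ln_realpow)
    moreover have "\<delta> * (2 * (1 / \<rho>)) = 2 * \<rho>" using \<rho> by (simp add: \<delta>_def power2_eq_square)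
    ultimately show ?thesis by simp
  qed
  then have small: "\<delta> * ln (1 / \<delta>) + \<delta> + 2 * \<delta> \<le> \<gamma> / 2" using \<delta> \<rho> by linarith
  \<comment> \<open>\<open>K * real n\<close> dominates the container term together with the 1 lost
    to the floor; beyond \<open>N\<close> it is at most the other half of the error
    allowance.\<close>
  define K where "K = ln 2 * (real (Suc k) + 4 ^ k) + (1 :: real)"
  obtain N where N: "real N > K / (\<gamma> / 2)" using reals_Archimedean2 by blast
  have "log 4 (real (card (DK3_free n))) - turan_entropy n \<le> \<gamma> * (real n)\<^sup>2" if n: "n \<ge> max 1 N" for n
  proof -
    have n1: "real n \<ge> 1" using n by simp
    have l43: "0 \<le> ln (4 / 3 :: real)" "ln (4 / 3 :: real) \<le> 1"
      using ln_le_minus_one[of "4 / 3 :: real"] by auto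
    have l4: "ln (4 :: real) \<ge> 1"
      using ln_mono[of "exp 1" "4 :: real"] exp_le by simp
    have fl: "real (n\<^sup>2 div 4) \<ge> (real n)\<^sup>2 / 4 - 1"
    proof -
      have "n\<^sup>2 \<le> 4 * (n\<^sup>2 div 4) + 4" by presburger
      then have "real (n\<^sup>2) \<le> real (4 * (n\<^sup>2 div 4) + 4)" by (rule of_nat_mono)
      then show ?thesis by simp
    qed
    have T: "turan_entropy n * ln 4 = real (n choose 2) * ln 3 + real (n\<^sup>2 div 4) * ln (4 / 3)"
      by (simp add: turan_entropy_def log_def ln_div field_simps)
    have M: "(1 / 4 + 2 * \<delta>) * (real n)\<^sup>2 * ln (4 / 3) - real (n\<^sup>2 div 4) * ln (4 / 3) \<le> 2 * \<delta> * (real n)\<^sup>2 + 1"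
    proof -
      have "((1 / 4 + 2 * \<delta>) * (real n)\<^sup>2 - real (n\<^sup>2 div 4)) * ln (4 / 3) \<le> (2 * \<delta> * (real n)\<^sup>2 + 1) * ln (4 / 3)"
        using fl l43 by (intro mult_right_mono) (auto simp: algebra_simps)
      also have "\<dots> \<le> (2 * \<delta> * (real n)\<^sup>2 + 1) * 1"
        using l43 \<delta> by (intro mult_left_mono) auto
      finally show ?thesis by (simp add: left_diff_distrib)
    qed
    have "ln 2 * (real (Suc k) * real n + 4 ^ k) + 1 \<le> K * real n"
    proof -
      have "ln 2 * (real (Suc k) * real n + 4 ^ k * 1) + 1 \<le> ln 2 * (real (Suc k) * real n + 4 ^ k * real n) + real n"
        using n1 by (intro add_mono mult_left_mono) auto
      then show ?thesis by (simp add: K_def algebra_simps)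
    qed
    also have "\<dots> \<le> (\<gamma> / 2 * real n) * real n"
    proof (rule mult_right_mono)
      have "K < real N * (\<gamma> / 2)" using N \<gamma> by (simp add: field_simps)
      also have "\<dots> \<le> real n * (\<gamma> / 2)" using n \<gamma> by (intro mult_right_mono) auto
      finally show "K \<le> \<gamma> / 2 * real n" by (simp add: mult.commute)
    qed simp
    finally have lin: "ln 2 * (real (Suc k) * real n + 4 ^ k) + 1 \<le> \<gamma> / 2 * (real n)\<^sup>2"
      by (simp add: power2_eq_square)
    have quad: "(\<delta> * ln (1 / \<delta>) + \<delta>) * (real n)\<^sup>2 + 2 * \<delta> * (real n)\<^sup>2 \<le> \<gamma> / 2 * (real n)\<^sup>2"
      using mult_right_mono[OF small, of "(real n)\<^sup>2"] by (simp only: distrib_right) simp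
    have "ln (real (card (DK3_free n))) - turan_entropy n * ln 4 \<le> \<gamma> * (real n)\<^sup>2"
      using card_DK3_free_le[of n \<delta> k] n \<delta> k T M lin quad by linarith
    \<comment> \<open>Since \<open>ln 4 \<ge> 1\<close>, passing from natural to base-4 logarithms
      preserves the bound.\<close>
    also have "\<dots> \<le> \<gamma> * (real n)\<^sup>2 * ln 4" using l4 \<gamma> mult_left_mono[of 1 "ln 4" "\<gamma> * (real n)\<^sup>2"] by simp
    finally show ?thesis by (simp add: log_def field_simps)
  qed
  then show ?thesis unfolding eventually_sequentially by blast
qed

theorem corollary4p4:
  shows "(\<exists>\<epsilon>. \<epsilon> \<in> o(\<lambda>n. real n ^ 2) \<and>
           (\<forall>n. real (card (DK3_free_digraphs n))
                  = 4 powr (entropy_density DK3_free * real (n choose 2) + \<epsilon> n)))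
       \<and> (\<exists>\<delta>. \<delta> \<in> o(\<lambda>n. real n ^ 2) \<and>
           (\<forall>n. real (card (DK3_free_digraphs n))
                  = 3 powr (real (n choose 2) - real (n\<^sup>2 div 4))
                    * 4 powr (real (n\<^sup>2 div 4) + \<delta> n)))"
proof -
  \<comment> \<open>\<open>L n\<close> is the exact base-4 exponent of the count. Both error terms
    are differences from it, so the two equations hold for every \<open>n\<close>, including small
    ones.\<close>
  define L where "L n = log 4 (real (card (DK3_free n)))" for n
  have pos: "real (card (DK3_free n)) > 0" for n
    using ex_le_card[of n] powr_gt_zero[of 4 "ex DK3_free n"] by linarith
  have L: "real (card (DK3_free_digraphs n)) = 4 powr L n" for n
    using pos[of n] by (simp add: L_def card_DK3_free_digraphs)
  have exL: "ex DK3_free n \<le> L n" for n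
    using ex_le_card[of n] pos[of n] by (simp add: L_def le_log_iff)
  have tex: "turan_entropy n \<le> ex DK3_free n" for n by (rule turan_entropy_le_ex)
  have excess: "(\<lambda>n. L n - turan_entropy n) \<in> o(\<lambda>n. real n ^ 2)"
  proof (rule landau_o.smallI)
    fix c :: real assume "c > 0"
    from log_card_excess[OF this]
    show "\<forall>\<^sub>F n in sequentially. norm (L n - turan_entropy n) \<le> c * norm (real n ^ 2)"
    proof eventually_elim
      case (elim n)
      then show ?case using exL[of n] tex[of n] by (simp add: L_def)
    qed
  qed
  \<comment> \<open>\<open>ex DK3_free n\<close> lies between \<open>turan_entropy n\<close> and
    \<open>L n\<close>, so its distance to \<open>L n\<close> is dominated by the whole gap.\<close>
  have "(\<lambda>n. L n - ex DK3_free n) \<in> O(\<lambda>n. L n - turan_entropy n)"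
  proof (rule bigoI[where c = 1], rule always_eventually, rule allI)
    fix n
    show "norm (L n - ex DK3_free n) \<le> 1 * norm (L n - turan_entropy n)"
      using exL[of n] tex[of n] by simp
  qed
  then have Lex: "(\<lambda>n. L n - ex DK3_free n) \<in> o(\<lambda>n. real n ^ 2)"
    using excess by (rule landau_o.big_small_trans)
  \<comment> \<open>The density is defined through \<open>lim\<close>; convergence makes it the
    actual limit of the normalised extremal entropies.\<close>
  have "(\<lambda>n. ex DK3_free n / real (n choose 2)) \<longlonglongrightarrow> entropy_density DK3_free"
    unfolding entropy_density_def using convergent_entropy_density convergent_LIMSEQ_iff by blast
  then have lim0: "(\<lambda>n. ex DK3_free n / real (n choose 2) - entropy_density DK3_free) \<longlonglongrightarrow> 0"
    by (simp add: LIM_zero_iff)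
  \<comment> \<open>The binomial coefficient vanishes for \<open>n < 2\<close>, so division by it is
    valid only eventually.\<close>
  have ev: "\<forall>\<^sub>F n in sequentially. real (n choose 2) \<noteq> 0"
    using eventually_ge_at_top[of 2] by eventually_elim simp
  have "(\<lambda>n. ex DK3_free n - entropy_density DK3_free * real (n choose 2)) \<in> o(\<lambda>n. real (n choose 2))"
  proof (rule smalloI_tendsto[OF _ ev])
    show "(\<lambda>n. (ex DK3_free n - entropy_density DK3_free * real (n choose 2)) / real (n choose 2)) \<longlonglongrightarrow> 0"
      by (rule Lim_transform_eventually[OF lim0]) (use ev in eventually_elim, simp add: diff_divide_distrib)
  qed
  moreover have "(\<lambda>n. real (n choose 2)) \<in> O(\<lambda>n. real n ^ 2)"
  proof (rule bigoI[where c = 1], rule always_eventually, rule allI)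
    fix n
    show "norm (real (n choose 2)) \<le> 1 * norm (real n ^ 2)" using choose_two_le_square[of n] by simp
  qed
  ultimately have "(\<lambda>n. ex DK3_free n - entropy_density DK3_free * real (n choose 2)) \<in> o(\<lambda>n. real n ^ 2)"
    by (rule landau_o.small_big_trans)
  from sum_in_smallo(1)[OF Lex this]
  have eps: "(\<lambda>n. L n - entropy_density DK3_free * real (n choose 2)) \<in> o(\<lambda>n. real n ^ 2)" by simp
  have "4 powr L n = 3 powr (real (n choose 2) - real (n\<^sup>2 div 4)) * 4 powr (real (n\<^sup>2 div 4) + (L n - turan_entropy n))" for n
  proof -
    have "3 powr x = 4 powr (x * log 4 3)" for x :: real
      by (simp add: powr_def log_def)
    then show ?thesis by (simp add: turan_entropy_def flip: powr_add)
  qed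
  then show ?thesis
    using eps excess L
    by (intro conjI exI[of _ "\<lambda>n. L n - entropy_density DK3_free * real (n choose 2)"]
      exI[of _ "\<lambda>n. L n - turan_entropy n"]) auto
qed

end
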